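(* Let $f(t_1,t_2)=At_1^2+Bt_1t_2+Ct_2^2$ be a primitive binary quadratic form with $A,B,C\in\mathbb{Z}$ whose Discriminant $\Delta\coloneqq B^2-4AC$ is nonzero, and suppose $f$ is isotropic, i.e. $\Delta=b^2$ for some $b\in\mathbb{Z}^+$. Then $\delta(f)>0$. More precisely, for each prime $p$ let $a_p=v_p(\Delta)$ (so each $a_p$ is even), put \[ \delta_2 \coloneqq \begin{cases} 1 & \text{if } a_2=0,\\ \frac{3}{4} & \text{if } a_2=2,\\ \frac{2+2^{4-a_2}+2^{5-a_2}+2^{2-a_2}}{12} & \text{if } a_2\geq 4,\end{cases} \] and for $p>2$ put \[ \delta_p \coloneqq \frac{p+p^{1-a_p}+2p^{-a_p}}{2p+2}. \] Then $\delta(f)=\prod_p \delta_p$, the product over all primes; moreover $\delta_p=1$ if and only if $a_p=0$, so the product may equivalently be taken over the primes dividing $\Delta$.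
   Context: A binary form is primitive if $\gcd(A,B,C)=1$. For a quadratic form $f\in\mathbb{Z}[t_1,\dots,t_n]$ let $D_f\coloneqq f(\mathbb{Z}^n)\setminus\{0\}$. For $S\subset\mathbb{Z}$: $S$ is positive if it contains no negative integers, negative if it contains no positive integers, indefinite otherwise. The density of $S$ is $\lim_{N\to\infty}\#(S\cap[1,N])/N$ if $S$ is positive, $\lim_{N\to\infty}\#(S\cap[-N,-1])/N$ if $S$ is negative, and $\lim_{N\to\infty}\#(S\cap[-N,N])/(2N)$ if $S$ is indefinite (the limit being required to exist). $\delta(f)$ denotes the density of $D_f$. $v_p$ is the $p$-adic valuation. *)

theory Defs
  imports "HOL-Analysis.Analysis" "HOL-Number_Theory.Number_Theory"
begin

definition bqf :: "int \<Rightarrow> int \<Rightarrow> int \<Rightarrow> int \<times> int \<Rightarrow> int" where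
  "bqf A B C = (\<lambda>(t1, t2). A * t1\<^sup>2 + B * t1 * t2 + C * t2\<^sup>2)"

definition primitive_bqf :: "int \<Rightarrow> int \<Rightarrow> int \<Rightarrow> bool" where
  "primitive_bqf A B C \<longleftrightarrow> Gcd {A, B, C} = 1"

definition discr :: "int \<Rightarrow> int \<Rightarrow> int \<Rightarrow> int" where
  "discr A B C = B\<^sup>2 - 4 * A * C"

definition isotropic_bqf :: "int \<Rightarrow> int \<Rightarrow> int \<Rightarrow> bool" where
  "isotropic_bqf A B C \<longleftrightarrow> (\<exists>b>0. discr A B C = b\<^sup>2)"

text \<open>For nonzero discriminant this agrees with the existence of a nontrivial zero.\<close>

lemma isotropic_bqf_iff_zero:
  assumes "discr A B C \<noteq> 0"
  shows "isotropic_bqf A B C \<longleftrightarrow> (\<exists>t. t \<noteq> (0, 0) \<and> bqf A B C t = 0)"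
proof
  assume "isotropic_bqf A B C"
  then obtain b where b: "b > 0" "discr A B C = b\<^sup>2"
    unfolding isotropic_bqf_def by blast
  show "\<exists>t. t \<noteq> (0, 0) \<and> bqf A B C t = 0"
  proof (cases "A = 0")
    case True
    then have "bqf A B C (1, 0) = 0" by (simp add: bqf_def)
    then show ?thesis by (metis one_neq_zero prod.inject)
  next
    case False
    have "bqf A B C (b - B, 2 * A) = A * (b\<^sup>2 - (B\<^sup>2 - 4 * A * C))"
      by (simp add: bqf_def power2_eq_square algebra_simps)
    also have "\<dots> = 0" using b(2) by (simp add: discr_def)
    finally show ?thesis using False by (intro exI[of _ "(b - B, 2 * A)"]) simp
  qed
next
  assume "\<exists>t. t \<noteq> (0, 0) \<and> bqf A B C t = 0"
  then obtain x y where xy: "(x, y) \<noteq> (0, 0)" "A * x\<^sup>2 + B * x * y + C * y\<^sup>2 = 0"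
    by (auto simp: bqf_def)
  have square: "isotropic_bqf A B C" if "u\<^sup>2 = discr A B C * v\<^sup>2" "v \<noteq> 0" for u v
  proof -
    have "v\<^sup>2 dvd u\<^sup>2" using that(1) by simp
    then have "v dvd u" by simp
    then obtain w where "u = v * w" by blast
    then have w: "discr A B C = w\<^sup>2"
      using that by (simp add: power_mult_distrib)
    then have "\<bar>w\<bar> > 0" using assms by auto
    with w show ?thesis unfolding isotropic_bqf_def by (metis power2_abs)
  qed
  show "isotropic_bqf A B C"
  proof (cases "y = 0")
    case False
    have "(2 * A * x + B * y)\<^sup>2 = discr A B C * y\<^sup>2 + 4 * A * (A * x\<^sup>2 + B * x * y + C * y\<^sup>2)"
      by (simp add: discr_def power2_eq_square algebra_simps)
    then show ?thesis using square[OF _ False] xy(2) by simp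
  next
    case True
    have "(2 * C * y + B * x)\<^sup>2 = discr A B C * x\<^sup>2 + 4 * C * (A * x\<^sup>2 + B * x * y + C * y\<^sup>2)"
      by (simp add: discr_def power2_eq_square algebra_simps)
    then show ?thesis using square[of _ x] True xy by simp
  qed
qed

definition nonzero_values :: "('a \<Rightarrow> int) \<Rightarrow> int set" where
  "nonzero_values f = range f - {0}"

definition positive_set :: "int set \<Rightarrow> bool" where
  "positive_set S \<longleftrightarrow> (\<forall>n\<in>S. \<not> n < 0)"

definition negative_set :: "int set \<Rightarrow> bool" where
  "negative_set S \<longleftrightarrow> (\<forall>n\<in>S. \<not> n > 0)"

text \<open>The first two cases overlap only for subsets of \<open>{0}\<close>, where both quotients vanish.\<close>

definition density_quotient :: "int set \<Rightarrow> nat \<Rightarrow> real" where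
  "density_quotient S N =
     (if positive_set S then real (card (S \<inter> {1..int N})) / real N
      else if negative_set S then real (card (S \<inter> {- int N..-1})) / real N
      else real (card (S \<inter> {- int N..int N})) / (2 * real N))"

definition has_density :: "int set \<Rightarrow> real \<Rightarrow> bool" where
  "has_density S d \<longleftrightarrow> density_quotient S \<longlonglongrightarrow> d"

text \<open>Meaningful only if the limit exists, that is, if some \<open>d\<close> satisfies \<open>has_density S d\<close>.\<close>

definition set_density :: "int set \<Rightarrow> real" where
  "set_density S = lim (density_quotient S)"

definition form_density :: "('a \<Rightarrow> int) \<Rightarrow> real" where
  "form_density f = set_density (nonzero_values f)"

text \<open>The factor at the prime \<open>p\<close> when the discriminant has valuation \<open>a\<close>. For
  square discriminants \<open>a\<close> is even, so for \<open>p = 2\<close> the last branch is the case \<open>a \<ge> 4\<close>.\<close>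

definition local_factor :: "nat \<Rightarrow> nat \<Rightarrow> real" where
  "local_factor p a =
     (if p = 2 then
        (if a = 0 then 1
         else if a = 2 then 3 / 4
         else (2 + 2 powi (4 - int a) + 2 powi (5 - int a) + 2 powi (2 - int a)) / 12)
      else (real p + real p powi (1 - int a) + 2 * real p powi (- int a)) / (2 * real p + 2))"

definition discr_val :: "int \<Rightarrow> int \<Rightarrow> int \<Rightarrow> nat \<Rightarrow> nat" where
  "discr_val A B C p = multiplicity (int p) (discr A B C)"

definition form_factor :: "int \<Rightarrow> int \<Rightarrow> int \<Rightarrow> nat \<Rightarrow> real" where
  "form_factor A B C p = local_factor p (discr_val A B C p)"

end

theory Submission
  imports Defs "HOL-Real_Asymp.Real_Asymp"
begin

text \<open>
  After a unimodular substitution the form is \<open>x (a x + b y)\<close> with \<open>a\<close> and \<open>b\<close> coprime, so \<open>n\<close> is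
  represented iff \<open>n = x z\<close> with \<open>z \<equiv> a x\<close> modulo \<open>b\<close>. Reducing modulo \<open>b\<^sup>2\<close> gives a periodic
  necessary condition, whose density is a product of local factors by the Chinese remainder
  theorem; at a power of \<open>p\<close> the factor satisfies a recursion in the exponent, because a local
  value is either congruent to \<open>a\<close> times a unit square or \<open>p\<^sup>2\<close> times a local value for the
  preceding power. An \<open>n\<close> satisfying the condition is represented as soon as it has divisors
  coprime to \<open>b\<close> in all unit classes modulo the divisors of \<open>b\<close>, as almost all \<open>n\<close> do.

  Dirichlet's theorem is not needed for the last point. Call a set of integers rich if almost all
  integers have a divisor in it, coprime to any prescribed number. Products of rich sets are rich,
  and so is every set containing primes with divergent reciprocal sum. Hence the primes whose class
  modulo \<open>q\<close> is not rich have a convergent reciprocal sum. In each unit class modulo \<open>q\<close>, the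
  integers without such prime factors then have positive density, and a single one of them, being
  a product of elements of rich classes, makes the class rich.
\<close>

section \<open>Density in symmetric intervals\<close>

definition proportion :: "int set \<Rightarrow> nat \<Rightarrow> real" where
  "proportion S N = real (card (S \<inter> {- int N..int N})) / (2 * real N)"

definition has_symmetric_density :: "int set \<Rightarrow> real \<Rightarrow> bool" where
  "has_symmetric_density S d \<longleftrightarrow> proportion S \<longlonglongrightarrow> d"

lemma proportion_nonneg: "proportion S N \<ge> 0"
  by (simp add: proportion_def)

lemma proportion_mono: "S \<subseteq> T \<Longrightarrow> proportion S N \<le> proportion T N"
  unfolding proportion_def by (intro divide_right_mono of_nat_mono card_mono) auto

lemma proportion_Un_le: "proportion (S \<union> T) N \<le> proportion S N + proportion T N"
proof -
  have "card ((S \<union> T) \<inter> {- int N..int N}) \<le>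
      card (S \<inter> {- int N..int N}) + card (T \<inter> {- int N..int N})"
    by (simp add: Int_Un_distrib2 card_Un_le)
  then have "real (card ((S \<union> T) \<inter> {- int N..int N})) \<le>
      real (card (S \<inter> {- int N..int N})) + real (card (T \<inter> {- int N..int N}))"
    by linarith
  then show ?thesis
    unfolding proportion_def by (simp add: divide_right_mono flip: add_divide_distrib)
qed

lemma proportion_UN_le:
  assumes "finite I"
  shows "proportion (\<Union>i\<in>I. S i) N \<le> (\<Sum>i\<in>I. proportion (S i) N)"
  using assms
proof induction
  case empty
  show ?case by (simp add: proportion_def)
next
  case (insert i I)
  have "proportion (\<Union>j\<in>insert i I. S j) N \<le> proportion (S i) N + proportion (\<Union>j\<in>I. S j) N"
    by (simp add: proportion_Un_le)
  with insert show ?case by simp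
qed

lemma has_symmetric_density_0I:
  assumes "\<And>\<epsilon>. \<epsilon> > 0 \<Longrightarrow> \<forall>\<^sub>F N in sequentially. proportion S N < \<epsilon>"
  shows "has_symmetric_density S 0"
  unfolding has_symmetric_density_def
  by (rule order_tendstoI)
    (auto intro: assms always_eventually order.strict_trans2[OF _ proportion_nonneg])

lemma has_symmetric_density_0_mono:
  assumes "S \<subseteq> T" "has_symmetric_density T 0"
  shows "has_symmetric_density S 0"
  unfolding has_symmetric_density_def
  by (rule tendsto_sandwich[OF _ _ tendsto_const assms(2)[unfolded has_symmetric_density_def]])
    (simp_all add: proportion_nonneg proportion_mono[OF assms(1)])

lemma has_symmetric_density_0_UN:
  assumes "finite I" "\<And>i. i \<in> I \<Longrightarrow> has_symmetric_density (S i) 0"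
  shows "has_symmetric_density (\<Union>i\<in>I. S i) 0"
proof -
  have "(\<lambda>N. \<Sum>i\<in>I. proportion (S i) N) \<longlonglongrightarrow> (\<Sum>i\<in>I. 0)"
    using assms(2) by (intro tendsto_sum) (simp add: has_symmetric_density_def)
  then have sum_lim: "(\<lambda>N. \<Sum>i\<in>I. proportion (S i) N) \<longlonglongrightarrow> 0" by simp
  show ?thesis
    unfolding has_symmetric_density_def
    by (rule tendsto_sandwich[OF _ _ tendsto_const sum_lim])
      (simp_all add: proportion_nonneg proportion_UN_le[OF assms(1)])
qed

lemma has_symmetric_density_singleton: "has_symmetric_density {n} 0"
proof -
  have lim: "(\<lambda>N. 1 / (2 * real N)) \<longlonglongrightarrow> 0" by real_asymp
  have "proportion {n} N \<le> 1 / (2 * real N)" for N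
    unfolding proportion_def using card_mono[of "{n}" "{n} \<inter> {- int N..int N}"]
    by (intro divide_right_mono) auto
  then show ?thesis
    unfolding has_symmetric_density_def
    by (intro tendsto_sandwich[OF always_eventually always_eventually tendsto_const lim]
        allI proportion_nonneg)
qed

lemma has_symmetric_density_null_Diff:
  assumes sub: "S \<subseteq> T" and dens: "has_symmetric_density T d"
    and null: "has_symmetric_density (T - S) 0"
  shows "has_symmetric_density S d"
proof -
  have upper: "proportion T \<longlonglongrightarrow> d" using dens by (simp add: has_symmetric_density_def)
  have "proportion (T - S) \<longlonglongrightarrow> 0" using null by (simp add: has_symmetric_density_def)
  from tendsto_diff[OF upper this]
  have lower: "(\<lambda>N. proportion T N - proportion (T - S) N) \<longlonglongrightarrow> d" by simp
  have "proportion T N - proportion (T - S) N \<le> proportion S N" for N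
    using proportion_Un_le[of S "T - S" N] sub by (simp add: Un_absorb1 diff_le_eq)
  then show ?thesis
    unfolding has_symmetric_density_def
    by (intro tendsto_sandwich[OF always_eventually always_eventually lower upper]
        allI proportion_mono[OF sub])
qed

section \<open>Periodic sets\<close>

definition periodic_set :: "int \<Rightarrow> int set \<Rightarrow> bool" where
  "periodic_set L S \<longleftrightarrow> (\<forall>m n. [m = n] (mod L) \<longrightarrow> (m \<in> S \<longleftrightarrow> n \<in> S))"

definition residue_class :: "int \<Rightarrow> int \<Rightarrow> int set" where
  "residue_class q g = {n. [n = g] (mod q)}"

definition residue_density :: "int \<Rightarrow> int set \<Rightarrow> real" where
  "residue_density L S = real (card (S \<inter> {0..<L})) / real_of_int L"

lemma periodic_setI:
  "(\<And>m n. [m = n] (mod L) \<Longrightarrow> m \<in> S \<Longrightarrow> n \<in> S) \<Longrightarrow> periodic_set L S"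
  unfolding periodic_set_def using cong_sym by blast

lemma periodic_set_cong_iff: "periodic_set L S \<Longrightarrow> [m = n] (mod L) \<Longrightarrow> m \<in> S \<longleftrightarrow> n \<in> S"
  by (simp add: periodic_set_def)

lemma periodic_set_mod_iff: "periodic_set L S \<Longrightarrow> n mod L \<in> S \<longleftrightarrow> n \<in> S"
  by (rule periodic_set_cong_iff) auto

lemma periodic_set_dvd: "periodic_set L S \<Longrightarrow> L dvd M \<Longrightarrow> periodic_set M S"
  unfolding periodic_set_def using cong_dvd_modulus by blast

lemma periodic_set_Int: "periodic_set L S \<Longrightarrow> periodic_set L T \<Longrightarrow> periodic_set L (S \<inter> T)"
  by (simp add: periodic_set_def)

lemma periodic_set_residue_class: "periodic_set q (residue_class q g)"
  by (simp add: periodic_set_def residue_class_def cong_def)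

lemma residue_class_eq: "[g = h] (mod q) \<Longrightarrow> residue_class q g = residue_class q h"
  by (simp add: residue_class_def cong_def)

lemma residue_density_residue_class:
  assumes "q > 0"
  shows "residue_density q (residue_class q g) = 1 / real_of_int q"
proof -
  have "residue_class q g \<inter> {0..<q} = {g mod q}"
    using assms by (auto simp: residue_class_def cong_def)
  then show ?thesis by (simp add: residue_density_def)
qed

lemma card_periodic_block:
  assumes "L > 0" "periodic_set L S"
  shows "card (S \<inter> {m..<m + L}) = card (S \<inter> {0..<L})"
proof -
  have "bij_betw (\<lambda>n. n mod L) (S \<inter> {m..<m + L}) (S \<inter> {0..<L})"
  proof (rule bij_betw_byWitness[where f' = "\<lambda>r. m + (r - m) mod L"])
    show "\<forall>n\<in>S \<inter> {m..<m + L}. m + (n mod L - m) mod L = n"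
    proof
      fix n assume "n \<in> S \<inter> {m..<m + L}"
      then have "(n - m) mod L = n - m" by simp
      then show "m + (n mod L - m) mod L = n" by (simp add: mod_diff_left_eq)
    qed
    show "\<forall>r\<in>S \<inter> {0..<L}. (m + (r - m) mod L) mod L = r"
      by (simp add: mod_add_right_eq)
    show "(\<lambda>n. n mod L) ` (S \<inter> {m..<m + L}) \<subseteq> S \<inter> {0..<L}"
      using assms periodic_set_mod_iff by auto
    have "[m + (r - m) mod L = r] (mod L)" for r
      by (simp add: cong_def mod_add_right_eq)
    then show "(\<lambda>r. m + (r - m) mod L) ` (S \<inter> {0..<L}) \<subseteq> S \<inter> {m..<m + L}"
      using assms periodic_set_cong_iff by fastforce
  qed
  then show ?thesis by (rule bij_betw_same_card)
qed

lemma card_periodic_blocks: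
  assumes "L > 0" "periodic_set L S"
  shows "card (S \<inter> {m..<m + int k * L}) = k * card (S \<inter> {0..<L})"
proof (induction k)
  case (Suc k)
  let ?e = "m + int k * L"
  have "{m..<?e} \<union> {?e..<?e + L} = {m..<?e + L}"
    using assms(1) by (intro ivl_disj_un_two(3)) simp_all
  then have "S \<inter> {m..<?e + L} = (S \<inter> {m..<?e}) \<union> (S \<inter> {?e..<?e + L})"
    by (metis Int_Un_distrib)
  moreover have "card ((S \<inter> {m..<?e}) \<union> (S \<inter> {?e..<?e + L})) =
      card (S \<inter> {m..<?e}) + card (S \<inter> {?e..<?e + L})"
    by (rule card_Un_disjoint) auto
  moreover have "m + int (Suc k) * L = ?e + L" by (simp add: distrib_right)
  ultimately show ?case
    using Suc card_periodic_block[OF assms, of ?e] by (simp only: mult_Suc add.commute)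
qed simp

lemma card_periodic_interval_approx:
  assumes L_pos: "L > 0" and "periodic_set L S"
  shows "\<bar>real (card (S \<inter> {m..<m + int l})) - real l * residue_density L S\<bar> \<le> real_of_int L"
proof -
  define k r where "k = nat (int l div L)" and "r = nat (int l mod L)"
  define e where "e = m + int k * L"
  define c where "c = card (S \<inter> {0..<L})"
  have int_l: "int l = int k * L + int r" and r_less: "int r < L"
    using L_pos by (simp_all add: k_def r_def pos_imp_zdiv_nonneg_iff)
  have "{m..<m + int l} = {m..<e} \<union> {e..<e + int r}"
    using L_pos by (subst ivl_disj_un_two(3)) (simp_all add: int_l e_def add.assoc)
  then have "card (S \<inter> {m..<m + int l}) = card ((S \<inter> {m..<e}) \<union> (S \<inter> {e..<e + int r}))"
    by (simp only: Int_Un_distrib)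
  also have "\<dots> = card (S \<inter> {m..<e}) + card (S \<inter> {e..<e + int r})"
    by (rule card_Un_disjoint) auto
  also have "card (S \<inter> {m..<e}) = k * c"
    unfolding e_def c_def by (rule card_periodic_blocks[OF assms])
  finally have card_eq: "card (S \<inter> {m..<m + int l}) = k * c + card (S \<inter> {e..<e + int r})" .
  have "c \<le> card {0..<L}" unfolding c_def by (intro card_mono) auto
  then have density_bounds: "0 \<le> residue_density L S" "residue_density L S \<le> 1"
    using L_pos by (simp_all add: residue_density_def c_def le_nat_iff)
  have "real l = real k * real_of_int L + real r"
    using arg_cong[OF int_l, of real_of_int] by simp
  then have "real l * residue_density L S = real (k * c) + real r * residue_density L S"
    using L_pos by (simp add: residue_density_def c_def field_simps)
  moreover have "card (S \<inter> {e..<e + int r}) \<le> card {e..<e + int r}" by (intro card_mono) auto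
  moreover have "0 \<le> real r * residue_density L S" "real r * residue_density L S \<le> real r"
    using density_bounds by (simp_all add: mult_left_le)
  ultimately show ?thesis using r_less by (simp add: card_eq abs_le_iff)
qed

lemma has_symmetric_density_periodic:
  assumes "L > 0" "periodic_set L S"
  shows "has_symmetric_density S (residue_density L S)"
proof -
  let ?\<rho> = "residue_density L S"
  have "norm (proportion S N - ?\<rho>) \<le> (real_of_int L + \<bar>?\<rho>\<bar>) / (2 * real N)" if "N > 0" for N
  proof -
    have "{- int N..int N} = {- int N..<- int N + int (2 * N + 1)}" by auto
    then have "\<bar>real (card (S \<inter> {- int N..int N})) - real (2 * N + 1) * ?\<rho>\<bar> \<le> real_of_int L"
      using card_periodic_interval_approx[OF assms, of "- int N" "2 * N + 1"] by simp
    then have "\<bar>real (card (S \<inter> {- int N..int N})) - 2 * real N * ?\<rho>\<bar> \<le> real_of_int L + \<bar>?\<rho>\<bar>"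
      by (simp add: algebra_simps)
    moreover have "proportion S N - ?\<rho> =
        (card (S \<inter> {- int N..int N}) - 2 * real N * ?\<rho>) / (2 * real N)"
      using that by (simp add: proportion_def diff_divide_distrib)
    ultimately show ?thesis by (simp add: divide_right_mono)
  qed
  then have "\<forall>\<^sub>F N in sequentially.
      norm (proportion S N - ?\<rho>) \<le> (real_of_int L + \<bar>?\<rho>\<bar>) / (2 * real N)"
    by (auto intro: eventually_sequentiallyI[of 1])
  moreover have "(\<lambda>N. (real_of_int L + \<bar>?\<rho>\<bar>) / (2 * real N)) \<longlonglongrightarrow> 0" by real_asymp
  ultimately have "(\<lambda>N. proportion S N - ?\<rho>) \<longlonglongrightarrow> 0" by (rule Lim_null_comparison)
  then show ?thesis by (simp add: has_symmetric_density_def LIM_zero_iff)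
qed

lemma residue_density_dvd:
  assumes "M > 0" "L dvd M" "L > 0" "periodic_set L S"
  shows "residue_density M S = residue_density L S"
proof (rule LIMSEQ_unique)
  show "proportion S \<longlonglongrightarrow> residue_density M S" "proportion S \<longlonglongrightarrow> residue_density L S"
    using has_symmetric_density_periodic[OF assms(1) periodic_set_dvd[OF assms(4,2)]]
      has_symmetric_density_periodic[OF assms(3,4)]
    by (simp_all only: has_symmetric_density_def)
qed

lemma residue_density_Int_coprime:
  assumes cop: "coprime q r" and q: "q > 0" "periodic_set q S" and r: "r > 0" "periodic_set r T"
  shows "residue_density (q * r) (S \<inter> T) = residue_density q S * residue_density r T"
proof -
  have "bij_betw (\<lambda>n. (n mod q, n mod r)) (S \<inter> T \<inter> {0..<q * r}) ((S \<inter> {0..<q}) \<times> (T \<inter> {0..<r}))"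
    unfolding bij_betw_def
  proof (intro conjI inj_onI equalityI subsetI)
    fix m n
    assume mn: "m \<in> S \<inter> T \<inter> {0..<q * r}" "n \<in> S \<inter> T \<inter> {0..<q * r}"
      "(m mod q, m mod r) = (n mod q, n mod r)"
    then have "[m = n] (mod q * r)"
      by (intro coprime_cong_mult[OF _ _ cop]) (simp_all add: cong_def)
    then show "m = n" using mn by (auto intro: cong_less_imp_eq_int)
  next
    fix y assume "y \<in> (\<lambda>n. (n mod q, n mod r)) ` (S \<inter> T \<inter> {0..<q * r})"
    then show "y \<in> (S \<inter> {0..<q}) \<times> (T \<inter> {0..<r})"
      using q(1) r(1) periodic_set_mod_iff[OF q(2)] periodic_set_mod_iff[OF r(2)] by auto
  next
    fix y assume "y \<in> (S \<inter> {0..<q}) \<times> (T \<inter> {0..<r})"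
    then obtain s t where y: "y = (s, t)" "s \<in> S" "s \<in> {0..<q}" "t \<in> T" "t \<in> {0..<r}"
      by auto
    obtain n where n: "[n = s] (mod q)" "[n = t] (mod r)"
      using binary_chinese_remainder_int[OF cop] by blast
    define k where "k = n mod (q * r)"
    have "k mod q = n mod q" "k mod r = n mod r" by (simp_all add: k_def mod_mod_cancel)
    moreover have "s mod q = s" "t mod r = t" using y(3,5) by simp_all
    ultimately have k: "k mod q = s" "k mod r = t" using n by (simp_all only: cong_def)
    then have "k \<in> S" "k \<in> T"
      using y periodic_set_mod_iff[OF q(2), of k] periodic_set_mod_iff[OF r(2), of k] by simp_all
    moreover have "k \<in> {0..<q * r}" using q(1) r(1) by (simp add: k_def)
    moreover have "y = (k mod q, k mod r)" using k y(1) by simp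
    ultimately show "y \<in> (\<lambda>n. (n mod q, n mod r)) ` (S \<inter> T \<inter> {0..<q * r})" by blast
  qed
  from bij_betw_same_card[OF this] show ?thesis
    by (simp add: residue_density_def card_cartesian_product)
qed

lemma residue_density_Un_disjoint:
  "S \<inter> T = {} \<Longrightarrow> residue_density L (S \<union> T) = residue_density L S + residue_density L T"
  unfolding residue_density_def Int_Un_distrib2
  by (subst card_Un_disjoint) (auto simp: add_divide_distrib)

lemma residue_density_dilate:
  assumes "c > 0"
  shows "residue_density (c * L) ((*) c ` S) = residue_density L S / real_of_int c"
proof -
  have "(*) c ` S \<inter> {0..<c * L} = (*) c ` (S \<inter> {0..<L})"
    using assms by (auto simp: zero_le_mult_iff)
  then have "card ((*) c ` S \<inter> {0..<c * L}) = card (S \<inter> {0..<L})"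
    using assms by (simp add: card_image inj_on_def)
  then show ?thesis by (simp add: residue_density_def)
qed

section \<open>Divisors in prescribed residue classes\<close>

definition nonmultiples :: "int set \<Rightarrow> int set" where
  "nonmultiples D = {n. \<forall>d\<in>D. \<not> d dvd n}"

text \<open>The set \<open>D\<close> of divisors is finite so that the divisors from a second rich set can be chosen
  coprime to all of them; this makes products of rich sets rich.\<close>

definition divisor_rich :: "int set \<Rightarrow> bool" where
  "divisor_rich G \<longleftrightarrow> (\<forall>\<epsilon>>0. \<forall>M. M \<noteq> 0 \<longrightarrow> (\<exists>D\<subseteq>G - {0}. finite D \<and>
     (\<forall>d\<in>D. coprime d M) \<and> (\<forall>\<^sub>F N in sequentially. proportion (nonmultiples D) N < \<epsilon>)))"

lemma divisor_richE:
  assumes "divisor_rich G" "\<epsilon> > 0" "M \<noteq> 0"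
  obtains D where "D \<subseteq> G - {0}" "finite D" "\<And>d. d \<in> D \<Longrightarrow> coprime d M"
    "\<forall>\<^sub>F N in sequentially. proportion (nonmultiples D) N < \<epsilon>"
  using assms unfolding divisor_rich_def by metis

lemma divisor_rich_unit:
  assumes "u \<in> G" "is_unit u"
  shows "divisor_rich G"
  unfolding divisor_rich_def
proof (intro allI impI exI[of _ "{u}"] conjI ballI)
  fix \<epsilon> :: real assume "\<epsilon> > 0"
  moreover have "nonmultiples {u} = {}"
    using assms(2) by (auto simp: nonmultiples_def unit_imp_dvd)
  ultimately show "\<forall>\<^sub>F N in sequentially. proportion (nonmultiples {u}) N < \<epsilon>"
    by (simp add: proportion_def)
qed (use assms in \<open>auto intro: is_unit_left_imp_coprime\<close>)

lemma nonmultiples_coprime_products_subset: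
  assumes "\<And>d e. d \<in> D \<Longrightarrow> e \<in> E \<Longrightarrow> coprime d e"
  shows "nonmultiples ((\<lambda>(d, e). d * e) ` (D \<times> E)) \<subseteq> nonmultiples D \<union> nonmultiples E"
proof
  fix n assume n: "n \<in> nonmultiples ((\<lambda>(d, e). d * e) ` (D \<times> E))"
  have "\<not> (d dvd n \<and> e dvd n)" if "d \<in> D" "e \<in> E" for d e
    using n that divides_mult[OF _ _ assms[OF that]] by (auto simp: nonmultiples_def)
  then show "n \<in> nonmultiples D \<union> nonmultiples E" by (auto simp: nonmultiples_def)
qed

lemma divisor_rich_mult:
  assumes rich_G: "divisor_rich G" and rich_H: "divisor_rich H"
    and mult: "\<And>g h. g \<in> G \<Longrightarrow> h \<in> H \<Longrightarrow> g * h \<in> K"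
  shows "divisor_rich K"
  unfolding divisor_rich_def
proof (intro allI impI)
  fix \<epsilon> :: real and M :: int
  assume \<epsilon>_pos: "\<epsilon> > 0" and M_nonzero: "M \<noteq> 0"
  obtain D where D: "D \<subseteq> G - {0}" "finite D" "\<And>d. d \<in> D \<Longrightarrow> coprime d M"
    "\<forall>\<^sub>F N in sequentially. proportion (nonmultiples D) N < \<epsilon> / 2"
    using divisor_richE[OF rich_G half_gt_zero[OF \<epsilon>_pos] M_nonzero] by blast
  have "M * \<Prod>D \<noteq> 0" using D(1,2) M_nonzero by auto
  then obtain E where E: "E \<subseteq> H - {0}" "finite E" "\<And>e. e \<in> E \<Longrightarrow> coprime e (M * \<Prod>D)"
    "\<forall>\<^sub>F N in sequentially. proportion (nonmultiples E) N < \<epsilon> / 2"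
    using divisor_richE[OF rich_H half_gt_zero[OF \<epsilon>_pos]] by blast
  define F where "F = (\<lambda>(d, e). d * e) ` (D \<times> E)"
  have "coprime d e" if "d \<in> D" "e \<in> E" for d e
  proof (rule coprime_divisors[OF _ dvd_refl])
    show "coprime (\<Prod>D) e" using E(3)[OF that(2)] by (simp add: coprime_commute)
    show "d dvd \<Prod>D" using dvd_prodI[OF D(2) that(1), of "\<lambda>x. x"] by simp
  qed
  then have F_sub: "nonmultiples F \<subseteq> nonmultiples D \<union> nonmultiples E"
    unfolding F_def by (rule nonmultiples_coprime_products_subset)
  have "\<forall>\<^sub>F N in sequentially. proportion (nonmultiples F) N < \<epsilon>"
    using D(4) E(4)
  proof eventually_elim
    case (elim N)
    then show ?case
      using proportion_mono[OF F_sub, of N] proportion_Un_le[of "nonmultiples D" "nonmultiples E" N]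
      by linarith
  qed
  moreover have "finite F" "F \<subseteq> K - {0}" "\<forall>d\<in>F. coprime d M"
    using D(1-3) E(1-3) by (auto simp: F_def intro!: mult)
  ultimately show "\<exists>D\<subseteq>K - {0}. finite D \<and> (\<forall>d\<in>D. coprime d M) \<and>
      (\<forall>\<^sub>F N in sequentially. proportion (nonmultiples D) N < \<epsilon>)"
    by blast
qed

lemma divisor_rich_imp_null:
  assumes "divisor_rich G" "M \<noteq> 0"
  shows "has_symmetric_density {n. \<not> (\<exists>d\<in>G. d dvd n \<and> coprime d M)} 0"
proof (rule has_symmetric_density_0I)
  fix \<epsilon> :: real assume "\<epsilon> > 0"
  then obtain D where D: "D \<subseteq> G - {0}" "\<And>d. d \<in> D \<Longrightarrow> coprime d M"
    "\<forall>\<^sub>F N in sequentially. proportion (nonmultiples D) N < \<epsilon>"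
    using divisor_richE[OF assms(1) _ assms(2)] by metis
  have sub: "{n. \<not> (\<exists>d\<in>G. d dvd n \<and> coprime d M)} \<subseteq> nonmultiples D"
    using D(1,2) by (auto simp: nonmultiples_def)
  from D(3) show "\<forall>\<^sub>F N in sequentially. proportion {n. \<not> (\<exists>d\<in>G. d dvd n \<and> coprime d M)} N < \<epsilon>"
    by eventually_elim (rule le_less_trans[OF proportion_mono[OF sub]])
qed

lemma periodic_set_nonmultiples:
  assumes "\<And>d. d \<in> D \<Longrightarrow> d dvd L"
  shows "periodic_set L (nonmultiples D)"
proof (rule periodic_setI)
  fix m n assume mn: "[m = n] (mod L)" and m: "m \<in> nonmultiples D"
  have "d dvd m \<longleftrightarrow> d dvd n" if "d \<in> D" for d
    using cong_dvd_modulus[OF mn assms[OF that]] by (rule cong_dvd_iff)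
  then show "n \<in> nonmultiples D" using m by (simp add: nonmultiples_def)
qed

lemma residue_density_nonmultiples_singleton:
  assumes "p > 0"
  shows "residue_density (int p) (nonmultiples {int p}) = 1 - 1 / real p"
proof -
  have "nonmultiples {int p} \<inter> {0..<int p} = {1..<int p}"
    by (auto simp: nonmultiples_def zdvd_not_zless order_le_less)
  then show ?thesis
    using assms by (simp add: residue_density_def of_nat_diff Suc_le_eq field_simps)
qed

lemma prod_primes_pos: "(\<And>p. p \<in> P \<Longrightarrow> prime p) \<Longrightarrow> \<Prod>P > (0::nat)"
  by (rule prod_pos) (simp add: prime_gt_0_nat)

lemma residue_density_nonmultiples_primes:
  assumes "finite P" "\<And>p. p \<in> P \<Longrightarrow> prime p"
  shows "residue_density (int (\<Prod>P)) (nonmultiples (int ` P)) = (\<Prod>p\<in>P. 1 - 1 / real p)"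
  using assms
proof (induction P rule: finite_induct)
  case empty
  show ?case by (simp add: residue_density_def nonmultiples_def)
next
  case (insert p P)
  have "coprime p r" if "r \<in> P" for r
    using insert.hyps(2) insert.prems that by (intro primes_coprime) auto
  then have "coprime p (\<Prod>P)" using prod_coprime_right[of P p "\<lambda>r. r"] by simp
  moreover have "int p > 0" "int (\<Prod>P) > 0"
    using insert.prems prime_gt_0_nat prod_primes_pos[of P] by (simp_all del: of_nat_prod)
  moreover have "periodic_set (int p) (nonmultiples {int p})"
    "periodic_set (int (\<Prod>P)) (nonmultiples (int ` P))"
    using insert.hyps(1) by (auto intro!: periodic_set_nonmultiples dvd_prodI)
  moreover have "nonmultiples (int ` insert p P) = nonmultiples {int p} \<inter> nonmultiples (int ` P)"
    by (auto simp: nonmultiples_def)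
  ultimately show ?case
    using insert residue_density_nonmultiples_singleton[of p]
      residue_density_Int_coprime[of "int p" "int (\<Prod>P)" "nonmultiples {int p}"
        "nonmultiples (int ` P)"]
    by (simp del: of_nat_prod)
qed

lemma has_symmetric_density_residue_class_avoiding_primes:
  assumes q_pos: "q > 0" and F: "finite F" "\<And>p. p \<in> F \<Longrightarrow> prime p" "\<And>p. p \<in> F \<Longrightarrow> coprime (int p) q"
  shows "has_symmetric_density (residue_class q g \<inter> nonmultiples (int ` F))
    ((\<Prod>p\<in>F. 1 - 1 / real p) / real_of_int q)"
proof -
  let ?A = "residue_class q g" and ?B = "nonmultiples (int ` F)" and ?L = "int (\<Prod>F)"
  have periodic_A: "periodic_set q ?A" by (rule periodic_set_residue_class)
  have periodic_B: "periodic_set ?L ?B"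
    using F(1) by (intro periodic_set_nonmultiples) (auto intro: dvd_prodI)
  have L_pos: "?L > 0" using prod_primes_pos[OF F(2)] by (simp only: of_nat_0_less_iff)
  have "coprime q ?L"
    using F(3) prod_coprime_right[of F q int] by (simp add: coprime_commute)
  then have "residue_density (q * ?L) (?A \<inter> ?B) = (\<Prod>p\<in>F. 1 - 1 / real p) / real_of_int q"
    using residue_density_Int_coprime[OF _ q_pos periodic_A L_pos periodic_B]
      residue_density_residue_class[OF q_pos] residue_density_nonmultiples_primes[OF F(1,2)] by simp
  moreover have "periodic_set (q * ?L) (?A \<inter> ?B)"
    using periodic_set_dvd[OF periodic_A] periodic_set_dvd[OF periodic_B]
    by (intro periodic_set_Int) simp_all
  moreover have "q * ?L > 0" using q_pos L_pos by simp
  ultimately show ?thesis using has_symmetric_density_periodic by metis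
qed

lemma prod_one_minus_tail_less:
  fixes f :: "nat \<Rightarrow> real"
  assumes f: "\<And>n. 0 \<le> f n" "\<And>n. f n \<le> 1" and divergent: "\<not> summable f" and "\<epsilon> > 0"
  obtains k where "(\<Prod>n\<in>{m..<k}. 1 - f n) < \<epsilon>"
proof -
  have "\<exists>k. - ln \<epsilon> < (\<Sum>i<k. f (i + m))"
    using divergent f(1) summableI_nonneg_bounded[of "\<lambda>i. f (i + m)" "- ln \<epsilon>"]
    by (force simp: summable_iff_shift not_less)
  then obtain k where k: "- ln \<epsilon> < (\<Sum>n\<in>{m..<k + m}. f n)"
    using sum.shift_bounds_nat_ivl[of f 0 m] by (auto simp: lessThan_atLeast0)
  have "(\<Prod>n\<in>{m..<k + m}. 1 - f n) \<le> (\<Prod>n\<in>{m..<k + m}. exp (- f n))"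
    using f(2) exp_ge_add_one_self[of "- f _"] by (intro prod_mono) simp
  also have "\<dots> = exp (- (\<Sum>n\<in>{m..<k + m}. f n))"
    by (simp add: exp_sum flip: sum_negf)
  also have "\<dots> < exp (ln \<epsilon>)" using k by simp
  finally show ?thesis using that[of "k + m"] \<open>\<epsilon> > 0\<close> by simp
qed

lemma divisor_rich_of_divergent_primes:
  assumes divergent: "\<not> summable (\<lambda>p. if prime p \<and> int p \<in> G then 1 / real p else 0)"
  shows "divisor_rich G"
  unfolding divisor_rich_def
proof (intro allI impI)
  fix \<epsilon> :: real and M :: int
  assume \<epsilon>_pos: "\<epsilon> > 0" and M_nonzero: "M \<noteq> 0"
  let ?f = "\<lambda>p. if prime p \<and> int p \<in> G then 1 / real p else 0"
  define m where "m = nat \<bar>M\<bar> + 1"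
  have "?f p \<ge> 0" "?f p \<le> 1" for p using prime_ge_1_nat[of p] by auto
  then obtain k where k: "(\<Prod>p\<in>{m..<k}. 1 - ?f p) < \<epsilon>"
    using prod_one_minus_tail_less[OF _ _ divergent \<epsilon>_pos] by blast
  define P where "P = {p \<in> {m..<k}. prime p \<and> int p \<in> G}"
  have P: "finite P" "\<And>p. p \<in> P \<Longrightarrow> prime p" "int ` P \<subseteq> G" by (auto simp: P_def)
  have "(\<Prod>p\<in>P. 1 - 1 / real p) = (\<Prod>p\<in>{m..<k}. 1 - ?f p)"
    unfolding P_def by (subst prod.inter_filter) (auto intro: prod.cong)
  moreover have "residue_class 1 0 = UNIV" by (simp add: residue_class_def)
  ultimately have "has_symmetric_density (nonmultiples (int ` P)) (\<Prod>p\<in>{m..<k}. 1 - ?f p)"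
    using has_symmetric_density_residue_class_avoiding_primes[of 1 P 0] P(1,2) by simp
  then have "\<forall>\<^sub>F N in sequentially. proportion (nonmultiples (int ` P)) N < \<epsilon>"
    using order_tendstoD(2) k unfolding has_symmetric_density_def by blast
  moreover have "coprime (int p) M" if "p \<in> P" for p
  proof (rule prime_imp_coprime)
    show "prime (int p)" using P(2)[OF that] by simp
    have "\<bar>M\<bar> < int p" using that by (auto simp: P_def m_def)
    then show "\<not> int p dvd M" using M_nonzero by (metis dvd_imp_le_int not_less abs_of_nat)
  qed
  moreover have "0 \<notin> int ` P" using P(2)[of 0] by auto
  ultimately show "\<exists>D\<subseteq>G - {0}. finite D \<and> (\<forall>d\<in>D. coprime d M) \<and>
      (\<forall>\<^sub>F N in sequentially. proportion (nonmultiples D) N < \<epsilon>)"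
    using P(1,3) by (intro exI[of _ "int ` P"]) auto
qed

lemma prod_one_minus_bounded_below:
  fixes f :: "nat \<Rightarrow> real"
  assumes "summable f" and f: "\<And>n. 0 \<le> f n" "\<And>n. f n < 1"
  obtains \<kappa> where "\<kappa> > 0" "\<And>k. \<kappa> \<le> (\<Prod>n<k. 1 - f n)"
proof -
  have "convergent_prod (\<lambda>n. 1 + - f n)"
    using assms by (intro summable_imp_convergent_prod_real) (auto simp: less_imp_neq)
  then have conv: "convergent_prod (\<lambda>n. 1 - f n)" by simp
  then have "(\<Prod>n. 1 - f n) > 0" using f(2) by (intro less_0_prodinf) auto
  moreover have "(\<Prod>n. 1 - f n) \<le> (\<Prod>n<k. 1 - f n)" for k
    using f
    by (intro prod_ge_prodinf[OF convergent_prod_has_prod[OF conv]]) (auto simp: less_imp_le)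
  ultimately show ?thesis using that by blast
qed

lemma proportion_multiples_le: "proportion ({n. int p dvd n} - {0}) N \<le> 1 / real p"
proof (cases "p = 0")
  case False
  let ?K = "{- int (N div p)..int (N div p)} - {0}"
  have "({n. int p dvd n} - {0}) \<inter> {- int N..int N} \<subseteq> (\<lambda>k. int p * k) ` ?K"
  proof
    fix n assume n: "n \<in> ({n. int p dvd n} - {0}) \<inter> {- int N..int N}"
    then obtain k where k: "n = int p * k" by auto
    then have "int p * \<bar>k\<bar> \<le> int N" using n by (auto simp: abs_if)
    then have "\<bar>k\<bar> \<le> int (N div p)"
      using zdiv_mono1[of "int p * \<bar>k\<bar>" "int N" "int p"] False by (simp add: zdiv_int)
    then have "k \<in> ?K" using n k by auto
    then show "n \<in> (\<lambda>k. int p * k) ` ?K" using k by blast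
  qed
  then have "card (({n. int p dvd n} - {0}) \<inter> {- int N..int N}) \<le> card ?K"
    by (rule surj_card_le[rotated]) simp
  also have "\<dots> = 2 * (N div p)" by simp
  finally have "real (card (({n. int p dvd n} - {0}) \<inter> {- int N..int N})) \<le> 2 * real (N div p)"
    by linarith
  also have "real (N div p) \<le> real N / real p" by (rule of_nat_div_le_of_nat)
  finally show ?thesis
    unfolding proportion_def using False by (cases "N = 0") (simp_all add: field_simps)
qed (simp add: proportion_def)

lemma proportion_multiples_Union_le:
  "proportion ({n. \<exists>p\<in>P. int p dvd n} - {0}) N \<le> (\<Sum>p\<in>P \<inter> {..N}. 1 / real p)"
proof -
  let ?M = "\<lambda>p. {n. int p dvd n} - {0}"
  have "p \<le> N" if "int p dvd n" "n \<noteq> 0" "n \<in> {- int N..int N}" for p n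
    using dvd_imp_le_int[OF that(2,1)] that(3) by auto
  then have "({n. \<exists>p\<in>P. int p dvd n} - {0}) \<inter> {- int N..int N} =
      (\<Union>p\<in>P \<inter> {..N}. ?M p) \<inter> {- int N..int N}"
    by blast
  then have "proportion ({n. \<exists>p\<in>P. int p dvd n} - {0}) N = proportion (\<Union>p\<in>P \<inter> {..N}. ?M p) N"
    by (simp only: proportion_def)
  also have "\<dots> \<le> (\<Sum>p\<in>P \<inter> {..N}. proportion (?M p) N)" by (rule proportion_UN_le) simp
  also have "\<dots> \<le> (\<Sum>p\<in>P \<inter> {..N}. 1 / real p)" by (intro sum_mono proportion_multiples_le)
  finally show ?thesis .
qed

lemma exists_nonzero_mem_Diff_of_density_less:
  assumes density_A: "has_symmetric_density A \<alpha>"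
    and proportion_B_le: "\<And>N. proportion B N \<le> \<beta>" and "\<beta> < \<alpha>"
  obtains n where "n \<in> A" "n \<notin> B" "n \<noteq> 0"
proof (rule ccontr)
  assume "\<not> thesis"
  then have "A \<subseteq> B \<union> {0}" using that by blast
  then have "proportion A N \<le> \<beta> + proportion {0} N" for N
    using proportion_B_le[of N] proportion_mono[of A "B \<union> {0}" N]
      proportion_Un_le[of B "{0}" N] by linarith
  moreover have "(\<lambda>N. \<beta> + proportion {0} N) \<longlonglongrightarrow> \<beta> + 0"
    using has_symmetric_density_singleton unfolding has_symmetric_density_def
    by (intro tendsto_intros)
  ultimately have "\<alpha> \<le> \<beta> + 0"
    using density_A unfolding has_symmetric_density_def by (intro LIMSEQ_le) auto
  with \<open>\<beta> < \<alpha>\<close> show False by simp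
qed

lemma proportion_multiples_tail_le:
  assumes "summable (\<lambda>p. if p \<in> P then 1 / real p else 0)" "\<epsilon> > 0"
  obtains z where "\<And>N. proportion ({n. \<exists>p\<in>P \<inter> {z..}. int p dvd n} - {0}) N \<le> \<epsilon>"
proof -
  let ?h = "\<lambda>p. if p \<in> P then 1 / real p else 0"
  obtain z where z: "\<And>k. norm (sum ?h {z..<k}) < \<epsilon>"
    using assms unfolding summable_Cauchy by blast
  have "proportion ({n. \<exists>p\<in>P \<inter> {z..}. int p dvd n} - {0}) N \<le> \<epsilon>" for N
  proof -
    have "(\<Sum>p\<in>P \<inter> {z..} \<inter> {..N}. 1 / real p) = sum ?h {z..<Suc N}"
      by (rule sum.mono_neutral_cong_left) auto
    also have "\<dots> \<le> norm (sum ?h {z..<Suc N})" by simp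
    also have "\<dots> \<le> \<epsilon>" using z less_imp_le by blast
    finally show ?thesis by (rule order.trans[OF proportion_multiples_Union_le])
  qed
  then show ?thesis by (rule that)
qed

lemma exists_cong_avoiding_sparse_primes:
  fixes q g :: int and P :: "nat set"
  assumes q_pos: "q > 0" and P: "\<And>p. p \<in> P \<Longrightarrow> prime p" "\<And>p. p \<in> P \<Longrightarrow> coprime (int p) q"
    and summable: "summable (\<lambda>p. if p \<in> P then 1 / real p else 0)"
  obtains n where "[n = g] (mod q)" "n \<noteq> 0" "\<And>p. p \<in> P \<Longrightarrow> \<not> int p dvd n"
proof -
  let ?h = "\<lambda>p. if p \<in> P then 1 / real p else 0"
  have "0 \<le> ?h p" "?h p < 1" for p using prime_gt_1_nat[OF P(1), of p] by auto
  then obtain \<kappa> where \<kappa>: "\<kappa> > 0" "\<And>k. \<kappa> \<le> (\<Prod>p<k. 1 - ?h p)"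
    using prod_one_minus_bounded_below[OF summable] by blast
  define \<epsilon> where "\<epsilon> = \<kappa> / real_of_int q"
  have \<epsilon>_pos: "\<epsilon> > 0" using \<kappa>(1) q_pos by (simp add: \<epsilon>_def)
  obtain z where z: "\<And>N. proportion ({n. \<exists>p\<in>P \<inter> {z..}. int p dvd n} - {0}) N \<le> \<epsilon> / 2"
    using proportion_multiples_tail_le[OF summable half_gt_zero[OF \<epsilon>_pos]] by blast
  define F where "F = P \<inter> {..<z}"
  have "(\<Prod>p\<in>F. 1 - 1 / real p) = (\<Prod>p<z. 1 - ?h p)"
    unfolding F_def by (rule prod.mono_neutral_cong_left) auto
  then have "\<epsilon> \<le> (\<Prod>p\<in>F. 1 - 1 / real p) / real_of_int q"
    using \<kappa>(2) q_pos by (simp add: \<epsilon>_def divide_right_mono)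
  then have less: "\<epsilon> / 2 < (\<Prod>p\<in>F. 1 - 1 / real p) / real_of_int q"
    using \<epsilon>_pos by linarith
  have "has_symmetric_density (residue_class q g \<inter> nonmultiples (int ` F))
      ((\<Prod>p\<in>F. 1 - 1 / real p) / real_of_int q)"
    using P by (intro has_symmetric_density_residue_class_avoiding_primes q_pos) (auto simp: F_def)
  then obtain n where n: "n \<in> residue_class q g \<inter> nonmultiples (int ` F)"
      "n \<notin> {n. \<exists>p\<in>P \<inter> {z..}. int p dvd n} - {0}" "n \<noteq> 0"
    using exists_nonzero_mem_Diff_of_density_less[OF _ z less] by blast
  show ?thesis
  proof (rule that[OF _ n(3)])
    show "[n = g] (mod q)" using n(1) by (simp add: residue_class_def)
    show "\<not> int p dvd n" if "p \<in> P" for p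
      using n that by (cases "p < z") (auto simp: F_def nonmultiples_def)
  qed
qed

lemma summable_primes_in_non_rich_classes:
  fixes q :: int
  assumes q_pos: "q > 0"
  shows "summable
    (\<lambda>p. if prime p \<and> \<not> divisor_rich (residue_class q (int p)) then 1 / real p else 0)"
proof -
  define R where "R = {r \<in> {0..<q}. \<not> divisor_rich (residue_class q r)}"
  let ?f = "\<lambda>r p. if prime p \<and> int p \<in> residue_class q r then 1 / real p else 0"
  have "finite R" by (rule finite_subset[of _ "{0..<q}"]) (auto simp: R_def)
  have "summable (\<lambda>p. \<Sum>r\<in>R. ?f r p)"
    using divisor_rich_of_divergent_primes by (intro summable_sum) (auto simp: R_def)
  then show ?thesis
  proof (rule summable_comparison_test[rotated], intro exI allI impI)
    fix p :: nat
    have sum_nonneg: "0 \<le> (\<Sum>r\<in>R. ?f r p)" by (intro sum_nonneg) simp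
    have "1 / real p \<le> (\<Sum>r\<in>R. ?f r p)" if "prime p" "\<not> divisor_rich (residue_class q (int p))"
    proof -
      have "[int p mod q = int p] (mod q)" by simp
      then have "int p mod q \<in> R" "int p \<in> residue_class q (int p mod q)"
        using that(2) q_pos residue_class_eq by (auto simp: R_def residue_class_def cong_sym)
      then show ?thesis
        using that(1) member_le_sum[of "int p mod q" R "\<lambda>r. ?f r p"] \<open>finite R\<close> by simp
    qed
    then show "norm (if prime p \<and> \<not> divisor_rich (residue_class q (int p)) then 1 / real p else 0)
        \<le> (\<Sum>r\<in>R. ?f r p)"
      using sum_nonneg by auto
  qed
qed

lemma divisor_rich_residue_class_of_prime_divisors:
  fixes n q :: int
  assumes "n \<noteq> 0" "\<And>p. prime p \<Longrightarrow> p dvd n \<Longrightarrow> divisor_rich (residue_class q p)"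
  shows "divisor_rich (residue_class q n)"
  using assms
proof (induction n rule: prime_divisors_induct)
  case (unit u)
  then show ?case by (intro divisor_rich_unit) (auto simp: residue_class_def)
next
  case (factor p m)
  then have "divisor_rich (residue_class q p)" "divisor_rich (residue_class q m)" by auto
  then show ?case
    by (rule divisor_rich_mult) (auto simp: residue_class_def cong_mult)
qed simp

theorem divisor_rich_residue_class:
  assumes q_pos: "q > 0" and coprime_g: "coprime g q"
  shows "divisor_rich (residue_class q g)"
proof -
  define P where "P = {p. prime p \<and> coprime (int p) q \<and> \<not> divisor_rich (residue_class q (int p))}"
  have "summable (\<lambda>p. if p \<in> P then 1 / real p else 0)"
    by (rule summable_comparison_test'[OF summable_primes_in_non_rich_classes[OF q_pos]])
      (simp add: P_def)
  then obtain n where n: "[n = g] (mod q)" "n \<noteq> 0" "\<And>p. p \<in> P \<Longrightarrow> \<not> int p dvd n"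
    using exists_cong_avoiding_sparse_primes[OF q_pos, of P g] unfolding P_def by blast
  have "coprime n q" using cong_imp_coprime[OF cong_sym[OF n(1)] coprime_g] .
  have "divisor_rich (residue_class q p)" if "prime p" "p dvd n" for p
  proof -
    have "coprime p q" using coprime_divisors[OF that(2) dvd_refl \<open>coprime n q\<close>] .
    then show ?thesis
      using that n(3)[of "nat p"] prime_ge_0_int[OF that(1)] by (auto simp: P_def)
  qed
  then have "divisor_rich (residue_class q n)"
    by (rule divisor_rich_residue_class_of_prime_divisors[OF n(2)])
  then show ?thesis by (simp add: residue_class_eq[OF n(1)])
qed

section \<open>Values modulo the squared modulus\<close>

definition local_values :: "int \<Rightarrow> int \<Rightarrow> int set" where
  "local_values a q = {n. \<exists>t. [n = bqf a q 0 t] (mod q\<^sup>2)}"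

definition local_density :: "int \<Rightarrow> int \<Rightarrow> real" where
  "local_density a q = residue_density (q\<^sup>2) (local_values a q)"

definition unit_values :: "int \<Rightarrow> int \<Rightarrow> int set" where
  "unit_values a q = {n. \<exists>u. coprime u q \<and> [n = a * u\<^sup>2] (mod q)}"

lemma bqf_0_right: "bqf a b 0 (x, y) = x * (a * x + b * y)"
  by (simp add: bqf_def power2_eq_square algebra_simps)

lemma range_bqf_subset_local_values: "range (bqf a q 0) \<subseteq> local_values a q"
  unfolding local_values_def by (blast intro: cong_refl)

lemma periodic_set_local_values: "periodic_set (q\<^sup>2) (local_values a q)"
  by (simp add: periodic_set_def local_values_def cong_def)

lemma periodic_set_unit_values: "periodic_set q (unit_values a q)"
  by (simp add: periodic_set_def unit_values_def cong_def)

lemma mem_local_values_iff_factors: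
  "n \<in> local_values a q \<longleftrightarrow> (\<exists>x z. [n = x * z] (mod q\<^sup>2) \<and> [z = a * x] (mod q))"
proof -
  have "[z = a * x] (mod q) \<longleftrightarrow> (\<exists>y. z = a * x + q * y)" for x z
    by (metis cong_iff_lin cong_sym)
  moreover have "n \<in> local_values a q \<longleftrightarrow> (\<exists>x y. [n = x * (a * x + q * y)] (mod q\<^sup>2))"
    by (simp add: local_values_def bqf_0_right)
  ultimately show ?thesis by auto
qed

lemma local_values_mult:
  assumes cop: "coprime q r"
  shows "local_values a (q * r) = local_values a q \<inter> local_values a r"
proof (intro equalityI subsetI)
  fix n assume "n \<in> local_values a (q * r)"
  then obtain x z where xz: "[n = x * z] (mod (q * r)\<^sup>2)" "[z = a * x] (mod (q * r))"
    by (auto simp: mem_local_values_iff_factors)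
  have "[n = x * z] (mod q\<^sup>2)" "[n = x * z] (mod r\<^sup>2)" "[z = a * x] (mod q)" "[z = a * x] (mod r)"
    using xz by (auto elim: cong_dvd_modulus simp: power_mult_distrib)
  then show "n \<in> local_values a q \<inter> local_values a r"
    by (auto simp: mem_local_values_iff_factors)
next
  fix n assume "n \<in> local_values a q \<inter> local_values a r"
  then obtain x\<^sub>1 z\<^sub>1 x\<^sub>2 z\<^sub>2 where
    q: "[n = x\<^sub>1 * z\<^sub>1] (mod q\<^sup>2)" "[z\<^sub>1 = a * x\<^sub>1] (mod q)" and
    r: "[n = x\<^sub>2 * z\<^sub>2] (mod r\<^sup>2)" "[z\<^sub>2 = a * x\<^sub>2] (mod r)"
    by (auto simp: mem_local_values_iff_factors)
  have cop_squares: "coprime (q\<^sup>2) (r\<^sup>2)" using cop by simp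
  obtain x where x: "[x = x\<^sub>1] (mod q\<^sup>2)" "[x = x\<^sub>2] (mod r\<^sup>2)"
    using binary_chinese_remainder_int[OF cop_squares] by blast
  obtain z where z: "[z = z\<^sub>1] (mod q\<^sup>2)" "[z = z\<^sub>2] (mod r\<^sup>2)"
    using binary_chinese_remainder_int[OF cop_squares] by blast
  have "[n = x * z] (mod q\<^sup>2)" "[n = x * z] (mod r\<^sup>2)"
    using q(1) r(1) x z by (meson cong_mult cong_sym cong_trans)+
  then have "[n = x * z] (mod (q * r)\<^sup>2)"
    using coprime_cong_mult[OF _ _ cop_squares] by (simp add: power_mult_distrib)
  moreover have "[x = x\<^sub>1] (mod q)" "[x = x\<^sub>2] (mod r)" "[z = z\<^sub>1] (mod q)" "[z = z\<^sub>2] (mod r)"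
    using x z by (auto elim: cong_dvd_modulus)
  then have "[z = a * x] (mod q)" "[z = a * x] (mod r)"
    using q(2) r(2) by (meson cong_scalar_left cong_sym cong_trans)+
  then have "[z = a * x] (mod (q * r))" using coprime_cong_mult[OF _ _ cop] by simp
  ultimately show "n \<in> local_values a (q * r)" by (auto simp: mem_local_values_iff_factors)
qed

lemma local_density_mult:
  assumes "coprime q r" "q > 0" "r > 0"
  shows "local_density a (q * r) = local_density a q * local_density a r"
  using assms residue_density_Int_coprime[of "q\<^sup>2" "r\<^sup>2" "local_values a q" "local_values a r"]
  by (simp add: local_density_def local_values_mult power_mult_distrib periodic_set_local_values)

lemma local_density_1: "local_density a 1 = 1"
proof -
  have "local_values a 1 = UNIV" by (auto simp: local_values_def)
  then show ?thesis by (simp add: local_density_def residue_density_def)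
qed

lemma unit_values_subset_local_values: "unit_values a q \<subseteq> local_values a q"
proof
  fix n assume "n \<in> unit_values a q"
  then obtain u where u: "coprime u q" "[n = a * u\<^sup>2] (mod q)" by (auto simp: unit_values_def)
  obtain w where w: "[u * w = 1] (mod q\<^sup>2)"
    using cong_solve_coprime_int[of u "q\<^sup>2"] u(1) by auto
  have n: "[n = u * (w * n)] (mod q\<^sup>2)"
    using cong_sym[OF cong_scalar_right[OF w, of n]] by (simp add: mult.assoc)
  then have "[u * (w * n) = n] (mod q)" by (auto intro: cong_sym cong_dvd_modulus)
  also note u(2)
  also have "a * u\<^sup>2 = u * (a * u)" by (simp add: power2_eq_square)
  finally have "[w * n = a * u] (mod q)" using u(1) cong_mult_lcancel by blast
  with n show "n \<in> local_values a q" by (auto simp: mem_local_values_iff_factors)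
qed

lemma local_values_scale:
  assumes "n \<in> local_values a q"
  shows "e\<^sup>2 * n \<in> local_values a (e * q)"
proof -
  obtain x z where xz: "[n = x * z] (mod q\<^sup>2)" "[z = a * x] (mod q)"
    using assms by (auto simp: mem_local_values_iff_factors)
  have "[e\<^sup>2 * n = e\<^sup>2 * (x * z)] (mod e\<^sup>2 * q\<^sup>2)" "[e * z = e * (a * x)] (mod e * q)"
    using xz by (simp_all add: cong_cmult_leftI)
  then have "[e\<^sup>2 * n = (e * x) * (e * z)] (mod (e * q)\<^sup>2)" "[e * z = a * (e * x)] (mod e * q)"
    by (simp_all add: power_mult_distrib power2_eq_square mult_ac)
  then show ?thesis by (auto simp: mem_local_values_iff_factors)
qed

text \<open>The square \<open>e\<^sup>2\<close> splits off because \<open>e = gcd x q\<close> also divides \<open>z\<close>.\<close>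

lemma local_values_reduceE:
  assumes q_pos: "q > 0" and n_local: "n \<in> local_values a q"
  obtains e c m where "e > 0" "q = e * c" "n = e\<^sup>2 * m" "m \<in> unit_values a c"
proof -
  obtain x z where xz: "[n = x * z] (mod q\<^sup>2)" "[z = a * x] (mod q)"
    using n_local by (auto simp: mem_local_values_iff_factors)
  define e where "e = gcd x q"
  have e_pos: "e > 0" using q_pos by (simp add: e_def)
  obtain x' c where x_eq: "x = e * x'" and q_eq: "q = e * c" and cop: "coprime x' c"
    using gcd_coprime_exists[of x q] q_pos unfolding e_def
    by (metis gcd_pos_int less_irrefl mult.commute)
  have "e dvd z" using cong_dvd_modulus[OF xz(2), of e] x_eq q_eq by (simp add: cong_dvd_iff)
  then obtain z' where z_eq: "z = e * z'" by blast
  have "[e * z' = e * (a * x')] (mod e * c)" using xz(2) by (simp add: x_eq z_eq q_eq mult_ac)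
  then have z'_cong: "[z' = a * x'] (mod c)"
    using e_pos by (simp add: cong_iff_dvd_diff flip: right_diff_distrib)
  have "e\<^sup>2 dvd n - x * z"
    using xz(1) by (auto simp: cong_iff_dvd_diff q_eq power_mult_distrib elim: dvd_mult_left)
  moreover have "e\<^sup>2 dvd x * z" by (simp add: x_eq z_eq power2_eq_square)
  ultimately have "e\<^sup>2 dvd n" by (metis dvd_diff_left_iff)
  then obtain m where n_eq: "n = e\<^sup>2 * m" by blast
  have "[e\<^sup>2 * m = e\<^sup>2 * (x' * z')] (mod e\<^sup>2 * c\<^sup>2)"
    using xz(1) by (simp add: n_eq x_eq z_eq q_eq power_mult_distrib power2_eq_square mult_ac)
  then have "[m = x' * z'] (mod c\<^sup>2)"
    using e_pos by (simp add: cong_iff_dvd_diff flip: right_diff_distrib)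
  then have "[m = x' * z'] (mod c)" by (rule cong_dvd_modulus) simp
  also have "[x' * z' = x' * (a * x')] (mod c)" using z'_cong by (rule cong_scalar_left)
  finally have "m \<in> unit_values a c"
    using cop by (auto simp: unit_values_def power2_eq_square mult_ac)
  then show ?thesis using that e_pos q_eq n_eq by blast
qed

lemma local_values_prime_power_Suc:
  fixes p :: int
  assumes prime_p: "prime p"
  shows "local_values a (p ^ Suc k) =
    unit_values a (p ^ Suc k) \<union> (*) (p\<^sup>2) ` local_values a (p ^ k)"
proof (intro equalityI subsetI)
  fix n assume "n \<in> local_values a (p ^ Suc k)"
  then obtain e c m where e: "e > 0" "p ^ Suc k = e * c" "n = e\<^sup>2 * m" "m \<in> unit_values a c"
    using local_values_reduceE[OF zero_less_power[OF prime_gt_0_int[OF prime_p]]] by blast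
  have "e dvd p ^ Suc k" using e(2) by simp
  then obtain i where i: "e = p ^ i"
    using divides_primepow[OF prime_p] e(1)
    by (metis normalize_idem_imp_is_unit_iff abs_of_pos normalize_int_def)
  show "n \<in> unit_values a (p ^ Suc k) \<union> (*) (p\<^sup>2) ` local_values a (p ^ k)"
  proof (cases i)
    case 0
    then show ?thesis using e i by simp
  next
    case (Suc j)
    have "p ^ k = p ^ j * c" using e(2) prime_p by (simp add: i Suc)
    then have "(p ^ j)\<^sup>2 * m \<in> local_values a (p ^ k)"
      using local_values_scale e(4) unit_values_subset_local_values by (metis subsetD)
    moreover have "n = p\<^sup>2 * ((p ^ j)\<^sup>2 * m)" by (simp add: e(3) i Suc power_mult_distrib)
    ultimately show ?thesis by blast
  qed
next
  fix n assume "n \<in> unit_values a (p ^ Suc k) \<union> (*) (p\<^sup>2) ` local_values a (p ^ k)"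
  then show "n \<in> local_values a (p ^ Suc k)"
    using unit_values_subset_local_values local_values_scale[of _ a "p ^ k" p] by auto
qed

lemma unit_values_not_dvd:
  fixes p :: int
  assumes "prime p" "coprime a p" "n \<in> unit_values a (p ^ Suc k)"
  shows "\<not> p dvd n"
proof -
  obtain u where u: "coprime u (p ^ Suc k)" "[n = a * u\<^sup>2] (mod p ^ Suc k)"
    using assms(3) by (auto simp: unit_values_def)
  have "[n = a * u\<^sup>2] (mod p)" using u(2) by (rule cong_dvd_modulus) simp
  moreover have "coprime (a * u\<^sup>2) p" using u(1) assms(2) by simp
  then have "\<not> p dvd a * u\<^sup>2"
    using assms(1) by (metis coprime_common_divisor dvd_refl not_prime_unit)
  ultimately show ?thesis using cong_dvd_iff by blast
qed

lemma local_density_prime_power_Suc: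
  fixes p :: int
  assumes prime_p: "prime p" and coprime_a: "coprime a p"
  shows "local_density a (p ^ Suc k) =
    residue_density (p ^ Suc k) (unit_values a (p ^ Suc k)) +
    local_density a (p ^ k) / real_of_int (p\<^sup>2)"
proof -
  let ?U = "unit_values a (p ^ Suc k)" and ?V = "(*) (p\<^sup>2) ` local_values a (p ^ k)"
  have p_pos: "p > 0" using prime_p by (rule prime_gt_0_int)
  have "n \<notin> ?V" if "n \<in> ?U" for n
    using unit_values_not_dvd[OF prime_p coprime_a that] by (auto simp: power2_eq_square)
  then have "?U \<inter> ?V = {}" by blast
  then have "local_density a (p ^ Suc k) =
      residue_density ((p ^ Suc k)\<^sup>2) ?U + residue_density ((p ^ Suc k)\<^sup>2) ?V"
    unfolding local_density_def local_values_prime_power_Suc[OF prime_p]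
    by (rule residue_density_Un_disjoint)
  also have "residue_density ((p ^ Suc k)\<^sup>2) ?U = residue_density (p ^ Suc k) ?U"
    using p_pos
    by (intro residue_density_dvd periodic_set_unit_values) (simp_all add: power2_eq_square)
  also have "(p ^ Suc k)\<^sup>2 = p\<^sup>2 * (p ^ k)\<^sup>2" by (simp add: power_mult_distrib)
  also have "residue_density (p\<^sup>2 * (p ^ k)\<^sup>2) ?V = local_density a (p ^ k) / real_of_int (p\<^sup>2)"
    unfolding local_density_def using p_pos by (intro residue_density_dilate) simp
  finally show ?thesis .
qed

section \<open>Counting unit squares\<close>

definition units_mod :: "int \<Rightarrow> int set" where
  "units_mod q = {u \<in> {0..<q}. coprime u q}"

definition square_roots_1 :: "int \<Rightarrow> int set" where
  "square_roots_1 q = {u \<in> {0..<q}. [u\<^sup>2 = 1] (mod q)}"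

lemma finite_units_mod [simp]: "finite (units_mod q)"
  by (rule finite_subset[of _ "{0..<q}"]) (auto simp: units_mod_def)

lemma card_units_mod:
  assumes "q > 1"
  shows "card (units_mod q) = totient (nat q)"
proof -
  interpret residues q "residue_ring q" using assms by unfold_locales simp_all
  have "u \<in> units_mod q \<longleftrightarrow> u \<in> Units (residue_ring q)" for u
    using assms by (cases "u = 0") (auto simp: units_mod_def res_units_eq)
  then have "units_mod q = Units (residue_ring q)" by blast
  then show ?thesis by (simp add: totient_eq)
qed

lemma scaled_square_mod_cong_iff: "[a * (u mod q)\<^sup>2 = b] (mod q) \<longleftrightarrow> [a * u\<^sup>2 = b] (mod (q::int))"
  unfolding cong_def by (metis mod_mult_right_eq power_mod)

lemma coprime_if_square_cong_1: "[u\<^sup>2 = 1] (mod q) \<Longrightarrow> coprime u (q::int)"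
  using cong_imp_coprime[OF cong_sym, of "u\<^sup>2" 1 q] by simp

lemma card_scaled_square_fibre:
  assumes coprime_a: "coprime a q" and coprime_v: "coprime v q" and q_pos: "q > 0"
  shows "card {u \<in> units_mod q. [a * u\<^sup>2 = a * v\<^sup>2] (mod q)} = card (square_roots_1 q)"
proof -
  obtain v' where v': "[v * v' = 1] (mod q)" using cong_solve_coprime_int[OF coprime_v] by blast
  have cancel: "[w * v' * v = w] (mod q)" "[w * v * v' = w] (mod q)" for w
    using cong_scalar_left[OF v', of w] by (simp_all add: mult_ac)
  have square_iff: "[a * (w * v)\<^sup>2 = a * v\<^sup>2] (mod q) \<longleftrightarrow> [w\<^sup>2 = 1] (mod q)" for w
    using coprime_a coprime_v cong_mult_lcancel[of "a * v\<^sup>2" q "w\<^sup>2" 1]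
    by (simp add: power_mult_distrib mult_ac)
  let ?F = "{u \<in> units_mod q. [a * u\<^sup>2 = a * v\<^sup>2] (mod q)}"
  have "bij_betw (\<lambda>w. w * v mod q) (square_roots_1 q) ?F"
  proof (rule bij_betw_byWitness[where f' = "\<lambda>u. u * v' mod q"])
    show "\<forall>w\<in>square_roots_1 q. (w * v mod q) * v' mod q = w"
      using cancel by (simp add: square_roots_1_def cong_def mod_mult_left_eq)
    show "\<forall>u\<in>?F. (u * v' mod q) * v mod q = u"
      using cancel by (simp add: units_mod_def cong_def mod_mult_left_eq)
    show "(\<lambda>w. w * v mod q) ` square_roots_1 q \<subseteq> ?F"
      using coprime_v q_pos coprime_if_square_cong_1
      by (auto simp: square_roots_1_def units_mod_def scaled_square_mod_cong_iff square_iff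
          coprime_mod_left_iff)
    show "(\<lambda>u. u * v' mod q) ` ?F \<subseteq> square_roots_1 q"
    proof safe
      fix u assume u: "[a * u\<^sup>2 = a * v\<^sup>2] (mod q)"
      have "[a * (u * v' * v)\<^sup>2 = a * u\<^sup>2] (mod q)"
        using cancel(1)[of u] by (intro cong_scalar_left cong_pow)
      then have "[(u * v')\<^sup>2 = 1] (mod q)" using u square_iff cong_trans by blast
      then show "u * v' mod q \<in> square_roots_1 q"
        using q_pos scaled_square_mod_cong_iff[of 1 "u * v'" q 1] by (simp add: square_roots_1_def)
    qed
  qed
  then show ?thesis by (simp add: bij_betw_same_card)
qed

lemma unit_values_residues_eq_image:
  assumes "q > 0"
  shows "unit_values a q \<inter> {0..<q} = (\<lambda>u. a * u\<^sup>2 mod q) ` units_mod q"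
proof (intro equalityI subsetI)
  fix n assume "n \<in> unit_values a q \<inter> {0..<q}"
  then obtain u where u: "coprime u q" "n = a * u\<^sup>2 mod q"
    by (auto simp: unit_values_def cong_def)
  then have "n = a * (u mod q)\<^sup>2 mod q"
    using scaled_square_mod_cong_iff[of a u q "a * u\<^sup>2"] by (simp add: cong_def)
  moreover have "u mod q \<in> units_mod q"
    using assms u(1) by (simp add: units_mod_def coprime_mod_left_iff)
  ultimately show "n \<in> (\<lambda>u. a * u\<^sup>2 mod q) ` units_mod q" by blast
qed (use assms in \<open>auto simp: unit_values_def units_mod_def cong_def\<close>)

lemma card_unit_values:
  assumes coprime_a: "coprime a q" and q_pos: "q > 0"
  shows "card (unit_values a q \<inter> {0..<q}) * card (square_roots_1 q) = card (units_mod q)"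
proof -
  let ?f = "\<lambda>u. a * u\<^sup>2 mod q"
  have "card {u \<in> units_mod q. ?f u = y} = card (square_roots_1 q)" if "y \<in> ?f ` units_mod q" for y
    using that card_scaled_square_fibre[OF coprime_a _ q_pos] by (auto simp: cong_def units_mod_def)
  then have "(\<Sum>y\<in>?f ` units_mod q. card {u \<in> units_mod q. ?f u = y}) =
      card (?f ` units_mod q) * card (square_roots_1 q)"
    by simp
  moreover have "card (units_mod q) = (\<Sum>y\<in>?f ` units_mod q. card {u \<in> units_mod q. ?f u = y})"
    using sum.image_gen[of "units_mod q" "\<lambda>_. 1::nat" ?f] by simp
  ultimately show ?thesis by (simp add: unit_values_residues_eq_image[OF q_pos])
qed

lemma residue_density_unit_values:
  assumes coprime_a: "coprime a q" and q_gt_1: "q > 1"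
  shows "residue_density q (unit_values a q) =
    real (totient (nat q)) / (real_of_int q * real (card (square_roots_1 q)))"
proof -
  have "1 \<in> square_roots_1 q" using q_gt_1 by (simp add: square_roots_1_def)
  moreover have "finite (square_roots_1 q)"
    by (rule finite_subset[of _ "{0..<q}"]) (auto simp: square_roots_1_def)
  ultimately have "card (square_roots_1 q) > 0" by (auto simp: card_gt_0_iff)
  moreover have "totient (nat q) = card (unit_values a q \<inter> {0..<q}) * card (square_roots_1 q)"
    using card_unit_values[OF coprime_a] card_units_mod[OF q_gt_1] q_gt_1 by simp
  ultimately show ?thesis by (simp add: residue_density_def)
qed

lemma square_roots_1_odd_prime_power:
  fixes p :: int
  assumes p: "prime p" "odd p"
  shows "square_roots_1 (p ^ Suc k) = {1, p ^ Suc k - 1}"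
proof -
  define Q where "Q = p ^ Suc k"
  have Q_gt_1: "Q > 1" unfolding Q_def by (rule one_less_power[OF prime_gt_1_int[OF p(1)]]) simp
  have "p \<noteq> 2" using p(2) by auto
  have dvd_cases: "Q dvd u - 1 \<or> Q dvd u + 1" if u: "Q dvd (u - 1) * (u + 1)" for u
  proof -
    have "\<not> p dvd 2" using p primes_dvd_imp_eq[of p 2] \<open>p \<noteq> 2\<close> by auto
    then have "\<not> (p dvd u - 1 \<and> p dvd u + 1)"
      using dvd_diff[of p "u + 1" "u - 1"] by auto
    then have "coprime Q (u - 1) \<or> coprime Q (u + 1)"
      using prime_imp_coprime[OF p(1)] by (auto simp: Q_def)
    then show ?thesis
      using u by (auto simp: coprime_dvd_mult_left_iff coprime_dvd_mult_right_iff)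
  qed
  have "u = 1 \<or> u = Q - 1" if u: "0 \<le> u" "u < Q" "Q dvd u\<^sup>2 - 1" for u
  proof -
    have "Q dvd u - 1 \<or> Q dvd u + 1"
      using u(3) by (intro dvd_cases) (simp add: power2_eq_square algebra_simps)
    moreover have "u = 1" if "Q dvd u - 1"
      using that u(1,2) Q_gt_1 zdvd_not_zless[of "u - 1" Q] zdvd_not_zless[of "1 - u" Q]
      by (cases u "1::int" rule: linorder_cases) (auto simp: dvd_diff_commute)
    moreover have "u = Q - 1" if "Q dvd u + 1"
      using that u(1,2) zdvd_not_zless[of "u + 1" Q] by linarith
    ultimately show ?thesis by blast
  qed
  moreover have "Q dvd (Q - 1)\<^sup>2 - 1"
    by (rule dvdI[of _ _ "Q - 2"]) (simp add: power2_eq_square algebra_simps)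
  ultimately have "square_roots_1 Q = {1, Q - 1}"
    using Q_gt_1 by (auto simp: square_roots_1_def cong_iff_dvd_diff)
  then show ?thesis by (simp only: Q_def)
qed

text \<open>For \<open>u = 2 w + 1\<close> the condition on \<open>u\<close> is that \<open>2 ^ (k + 1)\<close> divides \<open>w (w + 1)\<close>, whose
  factors are coprime.\<close>

lemma square_roots_1_power_two:
  fixes k :: nat
  defines "T \<equiv> 2 ^ (k + 1) :: int"
  shows "square_roots_1 (2 ^ (k + 3)) = {1, 2 * T - 1, 2 * T + 1, 4 * T - 1}"
proof -
  have power_eq: "(2::int) ^ (k + 3) = 4 * T" and T_ge_2: "T \<ge> 2" by (simp_all add: T_def power_add)
  have "u \<in> {1, 2 * T - 1, 2 * T + 1, 4 * T - 1}"
    if u: "0 \<le> u" "u < 4 * T" "4 * T dvd u\<^sup>2 - 1" for u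
  proof -
    have "even (u\<^sup>2 - 1)" using u(3) by (rule dvd_trans[rotated]) simp
    then have "odd u" by simp
    then obtain w where w: "u = 2 * w + 1" by (rule oddE)
    have "u\<^sup>2 - 1 = 4 * (w * (w + 1))" by (simp add: w power2_eq_square algebra_simps)
    then have "T dvd w * (w + 1)" using u(3) by simp
    moreover have "coprime T w \<or> coprime T (w + 1)" by (cases "even w") (auto simp: T_def)
    ultimately have "T dvd w \<or> T dvd w + 1"
      by (auto simp: coprime_dvd_mult_left_iff coprime_dvd_mult_right_iff)
    then obtain j where j: "w = T * j \<or> w + 1 = T * j" by (auto elim!: dvdE)
    have "0 \<le> w" "w < 2 * T" using u(1,2) w by auto
    then have "0 \<le> T * j" "T * j < T * 3" using j T_ge_2 by (elim disjE; linarith)+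
    then have "0 \<le> j" "j < 3" using T_ge_2 by (simp_all add: zero_le_mult_iff)
    then have "j \<in> {0, 1, 2}" by auto
    then show ?thesis using w j \<open>0 \<le> w\<close> \<open>w < 2 * T\<close> by auto
  qed
  moreover have "4 * T dvd u\<^sup>2 - 1" if "u \<in> {1, 2 * T - 1, 2 * T + 1, 4 * T - 1}" for u
  proof -
    have "(2 * T - 1)\<^sup>2 - 1 = 4 * T * (T - 1)" "(2 * T + 1)\<^sup>2 - 1 = 4 * T * (T + 1)"
      "(4 * T - 1)\<^sup>2 - 1 = 4 * T * (4 * T - 2)"
      by (simp_all add: power2_eq_square algebra_simps)
    then show ?thesis using that by auto
  qed
  ultimately show ?thesis
    using T_ge_2 unfolding power_eq by (auto simp: square_roots_1_def cong_iff_dvd_diff)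
qed

lemma square_roots_1_two: "square_roots_1 2 = {1}"
proof -
  have "{0..<2} = {0, 1::int}" by auto
  then show ?thesis unfolding square_roots_1_def by (auto simp: cong_def)
qed

lemma square_roots_1_four: "square_roots_1 4 = {1, 3}"
proof -
  have "{0..<4} = {0, 1, 2, 3::int}" by auto
  then show ?thesis unfolding square_roots_1_def by (auto simp: cong_def)
qed

lemma residue_density_unit_values_odd_prime_power:
  assumes p: "prime p" "odd p" and coprime_a: "coprime a (int p)"
  shows "residue_density (int p ^ Suc k) (unit_values a (int p ^ Suc k)) =
    (real p - 1) / (2 * real p)"
proof -
  have power_gt_1: "int p ^ Suc k > 1"
    using prime_gt_1_int[of "int p"] p(1) by (intro one_less_power) simp_all
  then have "int p ^ Suc k \<noteq> 2"
    using p(2) by (metis even_power even_of_nat_iff dvd_refl zero_less_Suc)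
  then have "card (square_roots_1 (int p ^ Suc k)) = 2"
    using p square_roots_1_odd_prime_power[of "int p" k] by simp
  moreover have "totient (nat (int p ^ Suc k)) = p ^ k * (p - 1)"
    using p(1) by (simp add: nat_power_eq totient_prime_power_Suc flip: of_nat_power power_Suc)
  ultimately show ?thesis
    using residue_density_unit_values[OF _ power_gt_1, of a] coprime_a p(1) prime_ge_1_nat[of p]
    by (simp add: of_nat_diff)
qed

lemma residue_density_unit_values_two:
  assumes "odd a"
  shows "residue_density 2 (unit_values a 2) = 1 / 2"
  using residue_density_unit_values[of a 2] assms by (simp add: square_roots_1_two)

lemma residue_density_unit_values_four:
  assumes "odd a"
  shows "residue_density 4 (unit_values a 4) = 1 / 4"
  using residue_density_unit_values[of a 4] assms totient_prime_power_Suc[of 2 1]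
    coprime_power_right_iff[of a 2 2]
  by (simp add: square_roots_1_four)

lemma residue_density_unit_values_power_two:
  assumes "odd a"
  shows "residue_density (2 ^ (k + 3)) (unit_values a (2 ^ (k + 3))) = 1 / 8"
proof -
  define T :: int where "T = 2 ^ (k + 1)"
  have "T \<ge> 2" by (simp add: T_def)
  then have "card (square_roots_1 (2 ^ (k + 3))) = 4"
    using square_roots_1_power_two[of k] unfolding T_def[symmetric] by simp
  moreover have "nat (2 ^ (k + 3)) = 2 ^ Suc (k + 2)"
    by (simp add: nat_power_eq power_add nat_mult_distrib)
  then have "totient (nat (2 ^ (k + 3))) = 2 ^ (k + 2)"
    using totient_prime_power_Suc[of 2 "k + 2"] by (simp only: two_is_prime_nat) simp
  moreover have "(2::int) ^ (k + 3) > 1" by (rule one_less_power) simp_all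
  moreover have "coprime a (2 ^ (k + 3))" using assms by simp
  ultimately show ?thesis
    using residue_density_unit_values[of a "2 ^ (k + 3)"] by (simp add: power_add)
qed

lemma local_factor_0: "p > 0 \<Longrightarrow> local_factor p 0 = 1"
  by (simp add: local_factor_def field_simps)

lemma local_factor_odd_Suc:
  assumes "p > 0" "odd p"
  shows "local_factor p (2 * Suc k) =
    (real p - 1) / (2 * real p) + local_factor p (2 * k) / (real p)\<^sup>2"
proof -
  have "p \<noteq> 2" using assms(2) by auto
  define t where "t = real p powi (- int (2 * k))"
  have "real p powi (1 - int (2 * k)) = real p * t"
    "real p powi (1 - int (2 * Suc k)) = t / real p"
    "real p powi (- int (2 * Suc k)) = t / (real p)\<^sup>2"
    using assms(1)
    by (simp_all add: t_def power_int_diff power_int_minus power_int_add power2_eq_square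
        field_simps)
  then have factors: "local_factor p (2 * k) = (real p + real p * t + 2 * t) / (2 * real p + 2)"
    "local_factor p (2 * Suc k) = (real p + t / real p + 2 * (t / (real p)\<^sup>2)) / (2 * real p + 2)"
    using \<open>p \<noteq> 2\<close> by (simp_all only: local_factor_def t_def if_False)
  show ?thesis
    unfolding factors using assms(1)
    by (simp add: divide_simps power2_eq_square) (simp add: algebra_simps)
qed

lemma local_factor_two_Suc:
  assumes "k \<ge> 2"
  shows "local_factor 2 (2 * Suc k) = 1 / 8 + local_factor 2 (2 * k) / 4"
proof -
  define t :: real where "t = 2 powi (- int (2 * k))"
  have powi: "(2::real) powi (m - int (2 * k)) = 2 powi m * t"
    "(2::real) powi (m - int (2 * Suc k)) = 2 powi m * t / 4" for m
    by (simp_all add: t_def power_int_diff power_int_minus power_int_add field_simps)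
  have "2 * k \<noteq> 2" "2 * Suc k \<noteq> 2" "2 * k \<noteq> 0" "2 * Suc k \<noteq> 0" using assms by auto
  then have "local_factor 2 (2 * k) = (2 + 16 * t + 32 * t + 4 * t) / 12"
    "local_factor 2 (2 * Suc k) = (2 + 16 * t / 4 + 32 * t / 4 + 4 * t / 4) / 12"
    by (simp_all only: local_factor_def powi if_True if_False refl) simp_all
  then show ?thesis by simp
qed

lemma residue_density_unit_values_eq_local_factor_diff:
  assumes prime_p: "prime p" and coprime_a: "coprime a (int p)"
  shows "residue_density (int p ^ Suc k) (unit_values a (int p ^ Suc k)) =
    local_factor p (2 * Suc k) - local_factor p (2 * k) / (real p)\<^sup>2"
proof (cases "p = 2")
  case False
  then have "odd p" using prime_p primes_dvd_imp_eq two_is_prime_nat by blast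
  then show ?thesis
    using residue_density_unit_values_odd_prime_power[OF prime_p _ coprime_a] local_factor_odd_Suc
      prime_gt_0_nat[OF prime_p] by simp
next
  case True
  then have "odd a" using coprime_a by simp
  consider "k = 0" | "k = 1" | j where "k = j + 2"
    by (metis One_nat_def add_2_eq_Suc' not0_implies_Suc)
  then show ?thesis
  proof cases
    assume "k = 0"
    then show ?thesis
      using True residue_density_unit_values_two[OF \<open>odd a\<close>] by (simp add: local_factor_def)
  next
    assume "k = 1"
    then show ?thesis
      using True residue_density_unit_values_four[OF \<open>odd a\<close>]
      by (simp add: local_factor_def power_int_minus)
  next
    fix j assume "k = j + 2"
    then show ?thesis
      using True residue_density_unit_values_power_two[OF \<open>odd a\<close>, of j]
        local_factor_two_Suc[of k]
      by (simp add: numeral_3_eq_3)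
  qed
qed

theorem local_density_prime_power:
  assumes prime_p: "prime p" and coprime_a: "coprime a (int p)"
  shows "local_density a (int p ^ k) = local_factor p (2 * k)"
proof (induction k)
  case 0
  show ?case using prime_gt_0_nat[OF prime_p] by (simp add: local_density_1 local_factor_0)
next
  case (Suc k)
  then show ?case
    using local_density_prime_power_Suc[OF _ coprime_a] prime_p
      residue_density_unit_values_eq_local_factor_diff[OF prime_p coprime_a] by simp
qed

section \<open>Represented integers\<close>

lemma unit_value_represented:
  assumes m_cong: "[m = a * u\<^sup>2] (mod q)" and d: "d dvd m" "[d = u] (mod q)" "coprime d q"
  shows "m \<in> range (bqf a q 0)"
proof -
  obtain k where m_eq: "m = d * k" using d(1) by blast
  have "[d * k = a * u\<^sup>2] (mod q)" using m_cong by (simp add: m_eq)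
  also have "[a * u\<^sup>2 = a * d\<^sup>2] (mod q)"
    by (intro cong_scalar_left cong_pow cong_sym[OF d(2)])
  also have "a * d\<^sup>2 = d * (a * d)" by (simp add: power2_eq_square)
  finally have "[k = a * d] (mod q)" using d(3) cong_mult_lcancel by blast
  then obtain y where "k = a * d + q * y" by (metis cong_iff_lin cong_sym)
  then have "m = bqf a q 0 (d, y)" by (simp add: m_eq bqf_0_right)
  then show ?thesis by blast
qed

lemma range_bqf_scale:
  assumes "n \<in> range (bqf a q 0)"
  shows "e\<^sup>2 * n \<in> range (bqf a (e * q) 0)"
proof -
  obtain x y where "n = bqf a q 0 (x, y)" using assms by auto
  then have "e\<^sup>2 * n = bqf a (e * q) 0 (e * x, y)"
    by (simp add: bqf_0_right power2_eq_square algebra_simps)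
  then show ?thesis by blast
qed

lemma local_value_represented:
  assumes b_pos: "b > 0" and n_local: "n \<in> local_values a b"
    and divisors: "\<And>c g. 0 < c \<Longrightarrow> c dvd b \<Longrightarrow> coprime g c \<Longrightarrow>
      \<exists>d\<in>residue_class c g. d dvd n \<and> coprime d b"
  shows "n \<in> range (bqf a b 0)"
proof -
  obtain e c m where e: "e > 0" "b = e * c" "n = e\<^sup>2 * m" and m: "m \<in> unit_values a c"
    using local_values_reduceE[OF b_pos n_local] .
  obtain u where u: "coprime u c" "[m = a * u\<^sup>2] (mod c)" using m by (auto simp: unit_values_def)
  have "c > 0" using b_pos e(1,2) by (simp add: zero_less_mult_iff)
  then obtain d where d: "[d = u] (mod c)" "d dvd n" "coprime d b"
    using divisors[OF _ _ u(1)] e(2) by (auto simp: residue_class_def)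
  then have "coprime d (e\<^sup>2)" "coprime d c" by (simp_all add: e(2))
  then have "d dvd m" using d(2) by (simp add: e(3) coprime_dvd_mult_right_iff)
  then have "m \<in> range (bqf a c 0)"
    using unit_value_represented[OF u(2) _ d(1)] \<open>coprime d c\<close> by blast
  then show ?thesis unfolding e(2,3) by (rule range_bqf_scale)
qed

lemma nonrepresented_local_values_null:
  assumes b_pos: "b > 0"
  shows "has_symmetric_density (local_values a b - range (bqf a b 0)) 0"
proof -
  define I where "I = (SIGMA c:{1..b}. units_mod c)"
  define N where "N = (\<lambda>(c, g). {n. \<not> (\<exists>d\<in>residue_class c g. d dvd n \<and> coprime d b)})"
  have "finite I" by (simp add: I_def)
  moreover have "has_symmetric_density (N i) 0" if "i \<in> I" for i
    using that b_pos divisor_rich_imp_null[OF divisor_rich_residue_class]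
    by (auto simp: I_def N_def units_mod_def)
  ultimately have "has_symmetric_density (\<Union>i\<in>I. N i) 0" by (rule has_symmetric_density_0_UN)
  moreover have "local_values a b - range (bqf a b 0) \<subseteq> (\<Union>i\<in>I. N i)"
  proof (rule ccontr)
    assume "\<not> ?thesis"
    then obtain n where n: "n \<in> local_values a b" "n \<notin> range (bqf a b 0)" "n \<notin> (\<Union>i\<in>I. N i)"
      by blast
    have "\<exists>d\<in>residue_class c g. d dvd n \<and> coprime d b" if c: "0 < c" "c dvd b" "coprime g c" for c g
    proof -
      have "(c, g mod c) \<in> I"
        using c b_pos by (simp add: I_def units_mod_def zdvd_imp_le coprime_mod_left_iff)
      then have "\<exists>d\<in>residue_class c (g mod c). d dvd n \<and> coprime d b"
        using n(3) by (auto simp: N_def)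
      moreover have "residue_class c (g mod c) = residue_class c g"
        by (rule residue_class_eq) simp
      ultimately show ?thesis by simp
    qed
    with n(1,2) show False using local_value_represented[OF b_pos] by blast
  qed
  ultimately show ?thesis by (rule has_symmetric_density_0_mono[rotated])
qed

theorem has_symmetric_density_nonzero_values_bqf_0:
  assumes b_pos: "b > 0"
  shows "has_symmetric_density (nonzero_values (bqf a b 0)) (local_density a b)"
proof (rule has_symmetric_density_null_Diff)
  show "nonzero_values (bqf a b 0) \<subseteq> range (bqf a b 0)"
    by (auto simp: nonzero_values_def)
  show "has_symmetric_density (range (bqf a b 0)) (local_density a b)"
  proof (rule has_symmetric_density_null_Diff[OF range_bqf_subset_local_values])
    show "has_symmetric_density (local_values a b) (local_density a b)"
      unfolding local_density_def using b_pos
      by (intro has_symmetric_density_periodic periodic_set_local_values) simp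
    show "has_symmetric_density (local_values a b - range (bqf a b 0)) 0"
      using b_pos by (rule nonrepresented_local_values_null)
  qed
  show "has_symmetric_density (range (bqf a b 0) - nonzero_values (bqf a b 0)) 0"
    by (rule has_symmetric_density_0_mono[OF _ has_symmetric_density_singleton])
      (auto simp: nonzero_values_def)
qed

lemma has_density_nonzero_values_bqf_0:
  assumes b_pos: "b > 0"
  shows "has_density (nonzero_values (bqf a b 0)) (local_density a b)"
proof -
  define k where "k = \<bar>a\<bar> + 1"
  have "\<bar>a\<bar> < k" by (simp add: k_def)
  also have "k \<le> b * k" using b_pos by (simp add: k_def)
  finally have "bqf a b 0 (1, k) > 0" "bqf a b 0 (1, - k) < 0"
    by (simp_all add: bqf_0_right abs_less_iff)
  then have "\<not> positive_set (nonzero_values (bqf a b 0))"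
      "\<not> negative_set (nonzero_values (bqf a b 0))"
    unfolding positive_set_def negative_set_def nonzero_values_def
    by (metis DiffI less_irrefl rangeI singletonD)+
  then have "density_quotient (nonzero_values (bqf a b 0)) =
      proportion (nonzero_values (bqf a b 0))"
    by (auto simp: density_quotient_def proportion_def)
  then show ?thesis
    using has_symmetric_density_nonzero_values_bqf_0[OF b_pos]
    by (simp add: has_density_def has_symmetric_density_def)
qed

section \<open>Normal form of isotropic forms\<close>

definition bqf_polar :: "int \<Rightarrow> int \<Rightarrow> int \<Rightarrow> int \<times> int \<Rightarrow> int \<times> int \<Rightarrow> int" where
  "bqf_polar A B C = (\<lambda>(u\<^sub>1, u\<^sub>2) (r\<^sub>1, r\<^sub>2).
     2 * A * u\<^sub>1 * r\<^sub>1 + B * (u\<^sub>1 * r\<^sub>2 + u\<^sub>2 * r\<^sub>1) + 2 * C * u\<^sub>2 * r\<^sub>2)"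

lemma bqf_substitution:
  "bqf A B C (u\<^sub>1 * x + r\<^sub>1 * y, u\<^sub>2 * x + r\<^sub>2 * y) =
    bqf (bqf A B C (u\<^sub>1, u\<^sub>2)) (bqf_polar A B C (u\<^sub>1, u\<^sub>2) (r\<^sub>1, r\<^sub>2)) (bqf A B C (r\<^sub>1, r\<^sub>2))
      (x, y)"
  by (simp add: bqf_def bqf_polar_def power2_eq_square algebra_simps)

lemma discr_substitution:
  "discr (bqf A B C (u\<^sub>1, u\<^sub>2)) (bqf_polar A B C (u\<^sub>1, u\<^sub>2) (r\<^sub>1, r\<^sub>2)) (bqf A B C (r\<^sub>1, r\<^sub>2)) =
    discr A B C * (u\<^sub>1 * r\<^sub>2 - u\<^sub>2 * r\<^sub>1)\<^sup>2"
  by (simp add: bqf_def bqf_polar_def discr_def power2_eq_square algebra_simps)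

lemma range_bqf_unimodular:
  assumes det: "u\<^sub>1 * r\<^sub>2 - u\<^sub>2 * r\<^sub>1 = 1"
  shows "range (bqf A B C) =
    range (bqf (bqf A B C (u\<^sub>1, u\<^sub>2)) (bqf_polar A B C (u\<^sub>1, u\<^sub>2) (r\<^sub>1, r\<^sub>2))
      (bqf A B C (r\<^sub>1, r\<^sub>2)))"
    (is "_ = range ?f")
proof (intro equalityI image_subsetI)
  fix t :: "int \<times> int"
  obtain s\<^sub>1 s\<^sub>2 where t: "t = (s\<^sub>1, s\<^sub>2)" by (cases t)
  let ?x = "r\<^sub>2 * s\<^sub>1 - r\<^sub>1 * s\<^sub>2" and ?y = "u\<^sub>1 * s\<^sub>2 - u\<^sub>2 * s\<^sub>1"
  have "u\<^sub>1 * ?x + r\<^sub>1 * ?y = s\<^sub>1 * (u\<^sub>1 * r\<^sub>2 - u\<^sub>2 * r\<^sub>1)"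
    "u\<^sub>2 * ?x + r\<^sub>2 * ?y = s\<^sub>2 * (u\<^sub>1 * r\<^sub>2 - u\<^sub>2 * r\<^sub>1)"
    by (simp_all add: algebra_simps)
  then have "bqf A B C t = ?f (?x, ?y)"
    using bqf_substitution[of A B C u\<^sub>1 ?x r\<^sub>1 ?y u\<^sub>2 r\<^sub>2] by (simp only: t det mult_1_right)
  then show "bqf A B C t \<in> range ?f" by blast
next
  fix t :: "int \<times> int"
  show "?f t \<in> range (bqf A B C)"
    by (cases t) (metis bqf_substitution rangeI)
qed

lemma isotropic_bqf_coprime_zero:
  assumes "isotropic_bqf A B C" "discr A B C \<noteq> 0"
  obtains r\<^sub>1 r\<^sub>2 where "coprime r\<^sub>1 r\<^sub>2" "bqf A B C (r\<^sub>1, r\<^sub>2) = 0"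
proof -
  obtain s t where st: "(s, t) \<noteq> (0, 0)" "bqf A B C (s, t) = 0"
    using assms isotropic_bqf_iff_zero by (metis surj_pair)
  then have gcd_nonzero: "gcd s t \<noteq> 0" by auto
  obtain r\<^sub>1 r\<^sub>2 where r: "s = r\<^sub>1 * gcd s t" "t = r\<^sub>2 * gcd s t" "coprime r\<^sub>1 r\<^sub>2"
    using gcd_coprime_exists[OF gcd_nonzero] by blast
  have "(gcd s t)\<^sup>2 * bqf A B C (r\<^sub>1, r\<^sub>2) = bqf A B C (r\<^sub>1 * gcd s t, r\<^sub>2 * gcd s t)"
    by (simp add: bqf_def power2_eq_square algebra_simps)
  also have "\<dots> = 0" using st(2) r(1,2) by simp
  finally have "bqf A B C (r\<^sub>1, r\<^sub>2) = 0" using gcd_nonzero by (metis mult_eq_0_iff power_eq_0_iff)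
  with r(3) show ?thesis by (rule that)
qed

lemma coprime_unimodular_completion:
  fixes r\<^sub>1 r\<^sub>2 :: int
  assumes "coprime r\<^sub>1 r\<^sub>2"
  obtains u\<^sub>1 u\<^sub>2 where "u\<^sub>1 * r\<^sub>2 - u\<^sub>2 * r\<^sub>1 = 1"
proof -
  obtain u v where "u * r\<^sub>1 + v * r\<^sub>2 = 1"
    using bezout_int[of r\<^sub>1 r\<^sub>2] assms by (metis coprime_iff_gcd_eq_1)
  then have "v * r\<^sub>2 - (- u) * r\<^sub>1 = 1" by simp
  then show ?thesis by (rule that)
qed

lemma primitive_bqf_common_divisor_unit:
  assumes prim: "primitive_bqf A B C" and dvd: "\<And>t. c dvd bqf A B C t"
  shows "is_unit c"
proof -
  have "c dvd A" "c dvd C" "c dvd A + B + C"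
    using dvd[of "(1, 0)"] dvd[of "(0, 1)"] dvd[of "(1, 1)"] by (simp_all add: bqf_def)
  then have "c dvd B" by (metis dvd_add_left_iff dvd_add_right_iff)
  then have "c dvd Gcd {A, B, C}"
    using \<open>c dvd A\<close> \<open>c dvd C\<close> by (intro Gcd_greatest) auto
  then show ?thesis using prim by (simp only: primitive_bqf_def)
qed

lemma range_bqf_uminus_middle: "range (bqf a (- b) 0) = range (bqf a b 0)"
proof -
  have "bqf a (- b) 0 (x, y) = bqf a b 0 (x, - y)" for x y by (simp add: bqf_0_right)
  then show ?thesis by (auto simp: image_iff) (metis minus_minus)+
qed

theorem isotropic_bqf_normal_form:
  assumes prim: "primitive_bqf A B C" and b: "b > 0" "discr A B C = b\<^sup>2"
  obtains a where "coprime a b" "range (bqf A B C) = range (bqf a b 0)"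
proof -
  have "isotropic_bqf A B C" "discr A B C \<noteq> 0" using b by (auto simp: isotropic_bqf_def)
  then obtain r\<^sub>1 r\<^sub>2 where r: "coprime r\<^sub>1 r\<^sub>2" "bqf A B C (r\<^sub>1, r\<^sub>2) = 0"
    by (rule isotropic_bqf_coprime_zero)
  obtain u\<^sub>1 u\<^sub>2 where det: "u\<^sub>1 * r\<^sub>2 - u\<^sub>2 * r\<^sub>1 = 1"
    using coprime_unimodular_completion[OF r(1)] .
  define a where "a = bqf A B C (u\<^sub>1, u\<^sub>2)"
  define B' where "B' = bqf_polar A B C (u\<^sub>1, u\<^sub>2) (r\<^sub>1, r\<^sub>2)"
  have "discr a B' 0 = b\<^sup>2"
    using discr_substitution[of A B C u\<^sub>1 u\<^sub>2 r\<^sub>1 r\<^sub>2]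
    by (simp only: det r(2) b(2) a_def B'_def) simp
  then have "B' = b \<or> B' = - b" by (simp add: discr_def power2_eq_iff)
  moreover have "range (bqf A B C) = range (bqf a B' 0)"
    using range_bqf_unimodular[OF det, of A B C] by (simp only: a_def B'_def r(2))
  ultimately have range: "range (bqf A B C) = range (bqf a b 0)"
    using range_bqf_uminus_middle[of a b] by auto
  have "coprime a b"
  proof (rule coprimeI)
    fix c assume c: "c dvd a" "c dvd b"
    have "c dvd bqf a b 0 t" for t using c by (cases t) (simp add: bqf_0_right)
    then have "c dvd bqf A B C t" for t using range by (metis rangeE rangeI)
    then show "is_unit c" by (rule primitive_bqf_common_divisor_unit[OF prim])
  qed
  then show ?thesis using range that by blast
qed

section \<open>The density as a product of local factors\<close>

lemma multiplicative_eq_prod_prime_powers: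
  fixes f :: "nat \<Rightarrow> 'a::comm_monoid_mult"
  assumes one: "f 1 = 1"
    and mult: "\<And>m n. m > 0 \<Longrightarrow> n > 0 \<Longrightarrow> coprime m n \<Longrightarrow> f (m * n) = f m * f n"
    and "n > 0"
  shows "f n = (\<Prod>p\<in>prime_factors n. f (p ^ multiplicity p n))"
proof -
  have "f (\<Prod>p\<in>P. p ^ multiplicity p n) = (\<Prod>p\<in>P. f (p ^ multiplicity p n))"
    if "finite P" "P \<subseteq> prime_factors n" for P
    using that
  proof (induction P rule: finite_induct)
    case (insert p P)
    have prime: "prime r" if "r \<in> insert p P" for r
      using that insert.prems in_prime_factors_imp_prime by blast
    then have "coprime p r" if "r \<in> P" for r
      using that insert.hyps(2) by (intro primes_coprime) auto
    then have "coprime (p ^ multiplicity p n) (\<Prod>r\<in>P. r ^ multiplicity r n)"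
      by (intro prod_coprime_right) simp
    moreover have "p ^ multiplicity p n > 0" "(\<Prod>r\<in>P. r ^ multiplicity r n) > 0"
      using prime by (auto intro!: prod_pos simp: prime_gt_0_nat)
    ultimately show ?case using insert mult by simp
  qed (use one in simp)
  from this[of "prime_factors n"] show ?thesis
    using prod_prime_factors[of n] \<open>n > 0\<close> by simp
qed

lemma local_density_eq_prod:
  fixes b :: nat
  assumes b_pos: "b > 0" and coprime_a: "coprime a (int b)"
  shows "local_density a (int b) = (\<Prod>p\<in>prime_factors b. local_factor p (2 * multiplicity p b))"
proof -
  have "local_density a (int b) =
      (\<Prod>p\<in>prime_factors b. local_density a (int (p ^ multiplicity p b)))"
    using b_pos
    by (intro multiplicative_eq_prod_prime_powers)
      (simp_all add: local_density_1 local_density_mult)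
  also have "\<dots> = (\<Prod>p\<in>prime_factors b. local_factor p (2 * multiplicity p b))"
  proof (rule prod.cong)
    fix p assume "p \<in> prime_factors b"
    then have p: "prime p" "int p dvd int b" by auto
    have "coprime a (int p)" using coprime_a coprime_divisors[OF dvd_refl p(2)] by blast
    then show "local_density a (int (p ^ multiplicity p b)) = local_factor p (2 * multiplicity p b)"
      using local_density_prime_power[OF p(1)] by simp
  qed simp
  finally show ?thesis .
qed

lemma local_factor_pos: "p > 0 \<Longrightarrow> local_factor p a > 0"
  by (auto simp: local_factor_def intro!: divide_pos_pos add_pos_pos)

lemma local_factor_less_1:
  assumes prime_p: "prime p" and a: "even a" "a \<noteq> 0"
  shows "local_factor p a < 1"
proof (cases "p = 2")
  case True
  show ?thesis
  proof (cases "a = 2")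
    case False
    then have "a \<ge> 4" using a by presburger
    then have "(2::real) powi (4 - int a) \<le> 2 powi 0" "(2::real) powi (5 - int a) \<le> 2 powi 1"
        "(2::real) powi (2 - int a) \<le> 2 powi 0"
      by (intro power_int_increasing; simp)+
    then show ?thesis using False True a(2) by (simp add: local_factor_def)
  qed (simp add: True local_factor_def)
next
  case False
  have p_gt_1: "real p > 1" using prime_gt_1_nat[OF prime_p] by simp
  have "real p powi (1 - int a) \<le> real p powi 0" "real p powi (- int a) < real p powi 0"
    using p_gt_1 a(2) by (intro power_int_increasing power_int_strict_increasing; simp)+
  then show ?thesis using False p_gt_1 by (simp add: local_factor_def)
qed

lemma multiplicity_of_nat_int: "multiplicity (int p) (int m) = multiplicity p m"
  by (simp add: multiplicity_def flip: of_nat_power)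

lemma discr_val_square:
  assumes "b > 0" "discr A B C = (int b)\<^sup>2" "prime p"
  shows "discr_val A B C p = 2 * multiplicity p b"
  using assms prime_elem_multiplicity_power_distrib[of "int p" "int b" 2]
  by (simp add: discr_val_def multiplicity_of_nat_int)

lemma isotropic_bqf_discr_natE:
  assumes "isotropic_bqf A B C"
  obtains b :: nat where "b > 0" "discr A B C = (int b)\<^sup>2"
  using assms unfolding isotropic_bqf_def by (metis zero_less_imp_eq_int)

lemma isotropic_discr_val_even:
  assumes "isotropic_bqf A B C" "prime p"
  shows "even (discr_val A B C p)"
  using isotropic_bqf_discr_natE[OF assms(1)] discr_val_square[OF _ _ assms(2)]
  by (metis dvd_triv_left)

lemma isotropic_form_factor_eq_1_iff:
  assumes "isotropic_bqf A B C" "prime p"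
  shows "form_factor A B C p = 1 \<longleftrightarrow> discr_val A B C p = 0"
  unfolding form_factor_def
  using local_factor_less_1[OF assms(2) isotropic_discr_val_even[OF assms]]
    local_factor_0[OF prime_gt_0_nat[OF assms(2)]]
  by (metis less_irrefl)

lemma finite_primes_dvd:
  assumes "m \<noteq> 0"
  shows "finite {p. prime p \<and> int p dvd m}"
proof (rule finite_subset)
  show "{p. prime p \<and> int p dvd m} \<subseteq> {p. p dvd nat \<bar>m\<bar>}"
    by (auto simp: nat_dvd_iff)
  show "finite {p. p dvd nat \<bar>m\<bar>}" using assms by (intro finite_divisors_nat) simp
qed

lemma isotropic_form_factor_has_prod:
  assumes "isotropic_bqf A B C" "discr A B C \<noteq> 0"
  shows "(\<lambda>p. if prime p then form_factor A B C p else 1) has_prod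
    (\<Prod>p | prime p \<and> int p dvd discr A B C. form_factor A B C p)"
proof -
  let ?P = "{p. prime p \<and> int p dvd discr A B C}"
  let ?f = "\<lambda>p. if prime p then form_factor A B C p else 1"
  have "?f p = 1" if "p \<notin> ?P" for p
    using that isotropic_form_factor_eq_1_iff[OF assms(1)]
    by (auto simp: discr_val_def not_dvd_imp_multiplicity_0)
  then have "?f has_prod (\<Prod>p\<in>?P. ?f p)"
    by (rule has_prod_finite[OF finite_primes_dvd[OF assms(2)]])
  also have "(\<Prod>p\<in>?P. ?f p) = (\<Prod>p\<in>?P. form_factor A B C p)" by (intro prod.cong) auto
  finally show ?thesis .
qed

theorem isotropic_bqf_has_density:
  assumes "primitive_bqf A B C" "isotropic_bqf A B C"
  shows "has_density (nonzero_values (bqf A B C))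
    (\<Prod>p | prime p \<and> int p dvd discr A B C. form_factor A B C p)"
proof -
  obtain b where b: "b > 0" "discr A B C = (int b)\<^sup>2"
    using isotropic_bqf_discr_natE[OF assms(2)] .
  then obtain a where a: "coprime a (int b)" "range (bqf A B C) = range (bqf a (int b) 0)"
    using isotropic_bqf_normal_form[OF assms(1), of "int b"] by auto
  have "{p. prime p \<and> int p dvd discr A B C} = prime_factors b"
    using b by (auto simp: in_prime_factors_iff prime_dvd_power_iff)
  moreover have "local_factor p (2 * multiplicity p b) = form_factor A B C p"
    if "p \<in> prime_factors b" for p
    using that by (simp add: form_factor_def discr_val_square[OF b] in_prime_factors_imp_prime)
  ultimately have "local_density a (int b) =
      (\<Prod>p | prime p \<and> int p dvd discr A B C. form_factor A B C p)"
    using local_density_eq_prod[OF b(1) a(1)] by simp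
  moreover have "nonzero_values (bqf A B C) = nonzero_values (bqf a (int b) 0)"
    by (simp add: nonzero_values_def a(2))
  ultimately show ?thesis using has_density_nonzero_values_bqf_0[of "int b" a] b(1) by simp
qed

theorem theorem1p6:
  fixes A B C :: int
  assumes "primitive_bqf A B C"
    and "discr A B C \<noteq> 0"
    and "isotropic_bqf A B C"
  shows "has_density (nonzero_values (bqf A B C)) (form_density (bqf A B C))
    \<and> form_density (bqf A B C) > 0
    \<and> (\<forall>p. prime p \<longrightarrow> even (discr_val A B C p))
    \<and> (\<lambda>p. if prime p then form_factor A B C p else 1) has_prod form_density (bqf A B C)
    \<and> (\<forall>p. prime p \<longrightarrow> (form_factor A B C p = 1 \<longleftrightarrow> discr_val A B C p = 0))
    \<and> form_density (bqf A B C) = (\<Prod>p | prime p \<and> int p dvd discr A B C. form_factor A B C p)"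
proof -
  have density: "has_density (nonzero_values (bqf A B C))
      (\<Prod>p | prime p \<and> int p dvd discr A B C. form_factor A B C p)"
    using assms(1,3) by (rule isotropic_bqf_has_density)
  then have product: "form_density (bqf A B C) =
      (\<Prod>p | prime p \<and> int p dvd discr A B C. form_factor A B C p)"
    by (simp add: form_density_def set_density_def has_density_def limI)
  have "form_density (bqf A B C) > 0"
    unfolding product form_factor_def
    by (intro prod_pos) (simp add: local_factor_pos prime_gt_0_nat)
  then show ?thesis
    using density isotropic_discr_val_even[OF assms(3)] isotropic_form_factor_eq_1_iff[OF assms(3)]
      isotropic_form_factor_has_prod[OF assms(3,2)]
    by (simp add: product)
qed

end
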